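(* Let $(M_i)_{i\in I}$ be an indexed family of $\mathcal{L}$-structures, let $D$ be an ultrafilter on $I$, and let $\mathcal{M}:=\prod_D M_i$. Let $\mu\in\mathfrak{M}_x(\mathcal{M})$ and $\nu\in\mathfrak{M}_y(\mathcal{M})$. Suppose that both $\mu$ and $\nu$ are pseudo-finite. If $\mu$ is ($\mathcal{M}$-)definable, then $\mu\otimes\nu=\mu\boxtimes\nu$, i.e. the Morley product of $\mu$ and $\nu$ agrees with their pseudo-finite product.
   Context: $\mathcal{L}$ is a first-order language; $I$ is an infinite index set; all ultrafilters are non-principal; letters $x,y,z$ denote finite tuples of variables. For an $\mathcal{L}$-structure $M$, $\mathcal{L}_x(M)$ is the collection of $\mathcal{L}$-formulas with parameters from $M$ and free variables $x$ (modulo equivalence in $M$), and $\mathfrak{M}_x(M)$ is the space of Keisler measures over $M$, i.e. finitely additive probability measures on $\mathcal{L}_x(M)$. For $p\in S_x(M)$, $\delta_p$ is the Dirac measure at $p$. Let $\mathrm{conv}_x(M)=\{\sum_{i=1}^n r_i\delta_{\mathrm{tp}(a_i/M)}: n\ge 1,\ a_i\in M^x,\ r_i>0,\ \sum_{i=1}^n r_i=1\}$. Ultralimits and pseudo-finiteness. Elements of $\mathcal{M}=\prod_D M_i$ are written $\mathbf{b}$, with representative $(\mathbf{b}(i))_{i\in I}$. Given $\mu_i\in\mathfrak{M}_x(M_i)$, the ultralimit $\lim_D\mu_i\in\mathfrak{M}_x(\mathcal{M})$ is the measure with $(\lim_D\mu_i)(\varphi(x,\mathbf{b}))=\lim_D\mu_i(\varphi(x,\mathbf{b}(i)))$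 for all $\varphi(x,\mathbf{b})\in\mathcal{L}_x(\mathcal{M})$. A measure $\mu\in\mathfrak{M}_x(\mathcal{M})$ is pseudo-finite if $\mu=\lim_D\mu_i$ for some $\mu_i\in\mathrm{conv}_x(M_i)$, $i\in I$. Definability. $\mu\in\mathfrak{M}_x(M)$ is $M$-definable (or definable) if for every $\mathcal{L}$-formula $\varphi(x,y)$ there is a (necessarily unique) continuous function $F^{\varphi}_{\mu,M}:S_y(M)\to[0,1]$ with $F^{\varphi}_{\mu,M}(\mathrm{tp}(b/M))=\mu(\varphi(x,b))$ for all $b\in M^y$. Morley product. If $\mu\in\mathfrak{M}_x(M)$ is $M$-definable and $\nu\in\mathfrak{M}_y(M)$, then $\mu\otimes\nu\in\mathfrak{M}_{xy}(M)$ is given by $(\mu\otimes\nu)(\varphi(x,y,c))=\int_{S_y(M)}F^{\varphi_c}_{\mu,M}\,d\tilde\nu$ for $\varphi(x,y,c)\in\mathcal{L}_{xy}(M)$, where $F^{\varphi_c}_{\mu,M}:S_y(M)\to[0,1]$ is the unique continuous map extending $\mathrm{tp}(b/M)\mapsto\mu(\varphi(x,b,c))$ and $\tilde\nu$ is the unique regular Borel probability measure on $S_y(M)$ with $\tilde\nu([\psi(y)])=\nu(\psi(y))$ for all $\psi(y)\in\mathcal{L}_y(M)$. Pseudo-finite product. If $\mu\in\mathfrak{M}_x(\mathcal{M})$ and $\nu\in\mathfrak{M}_y(\mathcal{M})$ are pseudo-finite, witnessed by $\mu_i\in\mathrm{conv}_x(M_i)$ and $\nu_i\in\mathrm{conv}_y(M_i)$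 with $\lim_D\mu_i=\mu$, $\lim_D\nu_i=\nu$, then $\mu\boxtimes\nu\in\mathfrak{M}_{xy}(\mathcal{M})$ is given by $(\mu\boxtimes\nu)(\varphi(x,y,\mathbf{c}))=\lim_D\big((\mu_i\otimes\nu_i)(\varphi(x,y,\mathbf{c}(i)))\big)$ for $\varphi(x,y,\mathbf{c})\in\mathcal{L}_{xy}(\mathcal{M})$; this does not depend on the choice of $(\mu_i)_{i\in I}$ and $(\nu_i)_{i\in I}$. *)

theory Defs
  imports "HOL-Probability.Probability"
begin

section \<open>First-order logic with parameters\<close>

text \<open>
  The symbols of a language are explicit sets, so that a language may have no function symbols
  or no relation symbols. Constants are function symbols of arity 0.
\<close>

record ('f, 'r) language =
  Funs :: "'f set"
  Rels :: "'r set"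
  fun_arity :: "'f \<Rightarrow> nat"
  rel_arity :: "'r \<Rightarrow> nat"

text \<open>
  Terms and formulas may contain elements of a type \<open>'p\<close> as parameters. A formula with parameters
  from \<open>A\<close> is one whose set of parameters \<open>pars_fm\<close> is contained in \<open>A\<close>; an \<open>L\<close>-formula is one
  with no parameters. The map functions \<open>map_tm\<close>, \<open>map_fm\<close> replace parameters.
\<close>

datatype (dead 'f, pars_tm: 'p) tm =
  Var nat | Par 'p | Fn 'f "('f, 'p) tm list"
  for map: map_tm

datatype (dead 'f, dead 'r, pars_fm: 'p) fm =
  Falsum
| Equal "('f, 'p) tm" "('f, 'p) tm"
| Rel 'r "('f, 'p) tm list"
| Neg "('f, 'r, 'p) fm"
| Conj "('f, 'r, 'p) fm" "('f, 'r, 'p) fm"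
| Exists nat "('f, 'r, 'p) fm"
  for map: map_fm

abbreviation Verum :: "('f, 'r, 'p) fm" where
  "Verum \<equiv> Neg Falsum"

abbreviation Disj :: "('f, 'r, 'p) fm \<Rightarrow> ('f, 'r, 'p) fm \<Rightarrow> ('f, 'r, 'p) fm" where
  "Disj \<phi> \<psi> \<equiv> Neg (Conj (Neg \<phi>) (Neg \<psi>))"

primrec wf_tm :: "('f, 'r) language \<Rightarrow> ('f, 'p) tm \<Rightarrow> bool" where
  "wf_tm L (Var v) \<longleftrightarrow> True"
| "wf_tm L (Par a) \<longleftrightarrow> True"
| "wf_tm L (Fn f ts) \<longleftrightarrow> f \<in> Funs L \<and> length ts = fun_arity L f \<and> list_all id (map (wf_tm L) ts)"

primrec wf_fm :: "('f, 'r) language \<Rightarrow> ('f, 'r, 'p) fm \<Rightarrow> bool" where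
  "wf_fm L Falsum \<longleftrightarrow> True"
| "wf_fm L (Equal s t) \<longleftrightarrow> wf_tm L s \<and> wf_tm L t"
| "wf_fm L (Rel R ts) \<longleftrightarrow> R \<in> Rels L \<and> length ts = rel_arity L R \<and> list_all (wf_tm L) ts"
| "wf_fm L (Neg \<phi>) \<longleftrightarrow> wf_fm L \<phi>"
| "wf_fm L (Conj \<phi> \<psi>) \<longleftrightarrow> wf_fm L \<phi> \<and> wf_fm L \<psi>"
| "wf_fm L (Exists v \<phi>) \<longleftrightarrow> wf_fm L \<phi>"

primrec fv_tm :: "('f, 'p) tm \<Rightarrow> nat set" where
  "fv_tm (Var v) = {v}"
| "fv_tm (Par a) = {}"
| "fv_tm (Fn f ts) = \<Union>(set (map fv_tm ts))"

primrec fv_fm :: "('f, 'r, 'p) fm \<Rightarrow> nat set" where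
  "fv_fm Falsum = {}"
| "fv_fm (Equal s t) = fv_tm s \<union> fv_tm t"
| "fv_fm (Rel R ts) = \<Union>(set (map fv_tm ts))"
| "fv_fm (Neg \<phi>) = fv_fm \<phi>"
| "fv_fm (Conj \<phi> \<psi>) = fv_fm \<phi> \<union> fv_fm \<psi>"
| "fv_fm (Exists v \<phi>) = fv_fm \<phi> - {v}"

text \<open>\<open>inst_fm Y b \<phi>\<close> is \<open>\<phi>(x,b)\<close>: free variables \<open>v \<in> Y\<close> are replaced by the parameters \<open>b v\<close>.\<close>

primrec inst_tm :: "nat set \<Rightarrow> (nat \<Rightarrow> 'p) \<Rightarrow> ('f, 'p) tm \<Rightarrow> ('f, 'p) tm" where
  "inst_tm Y b (Var v) = (if v \<in> Y then Par (b v) else Var v)"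
| "inst_tm Y b (Par a) = Par a"
| "inst_tm Y b (Fn f ts) = Fn f (map (inst_tm Y b) ts)"

primrec inst_fm :: "nat set \<Rightarrow> (nat \<Rightarrow> 'p) \<Rightarrow> ('f, 'r, 'p) fm \<Rightarrow> ('f, 'r, 'p) fm" where
  "inst_fm Y b Falsum = Falsum"
| "inst_fm Y b (Equal s t) = Equal (inst_tm Y b s) (inst_tm Y b t)"
| "inst_fm Y b (Rel R ts) = Rel R (map (inst_tm Y b) ts)"
| "inst_fm Y b (Neg \<phi>) = Neg (inst_fm Y b \<phi>)"
| "inst_fm Y b (Conj \<phi> \<psi>) = Conj (inst_fm Y b \<phi>) (inst_fm Y b \<psi>)"
| "inst_fm Y b (Exists v \<phi>) = Exists v (inst_fm (Y - {v}) b \<phi>)"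

record ('f, 'r, 'a) fo_struct =
  universe :: "'a set"
  fun_interp :: "'f \<Rightarrow> 'a list \<Rightarrow> 'a"
  rel_interp :: "'r \<Rightarrow> 'a list \<Rightarrow> bool"

definition is_struct :: "('f, 'r) language \<Rightarrow> ('f, 'r, 'a) fo_struct \<Rightarrow> bool" where
  "is_struct L M \<longleftrightarrow> universe M \<noteq> {} \<and>
     (\<forall>f\<in>Funs L. \<forall>as. set as \<subseteq> universe M \<and> length as = fun_arity L f \<longrightarrow>
        fun_interp M f as \<in> universe M)"

primrec eval_tm :: "('f, 'r, 'a) fo_struct \<Rightarrow> (nat \<Rightarrow> 'a) \<Rightarrow> ('f, 'a) tm \<Rightarrow> 'a" where
  "eval_tm M e (Var v) = e v"
| "eval_tm M e (Par a) = a"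
| "eval_tm M e (Fn f ts) = fun_interp M f (map (eval_tm M e) ts)"

primrec satisfies :: "('f, 'r, 'a) fo_struct \<Rightarrow> (nat \<Rightarrow> 'a) \<Rightarrow> ('f, 'r, 'a) fm \<Rightarrow> bool" where
  "satisfies M e Falsum \<longleftrightarrow> False"
| "satisfies M e (Equal s t) \<longleftrightarrow> eval_tm M e s = eval_tm M e t"
| "satisfies M e (Rel R ts) \<longleftrightarrow> rel_interp M R (map (eval_tm M e) ts)"
| "satisfies M e (Neg \<phi>) \<longleftrightarrow> \<not> satisfies M e \<phi>"
| "satisfies M e (Conj \<phi> \<psi>) \<longleftrightarrow> satisfies M e \<phi> \<and> satisfies M e \<psi>"
| "satisfies M e (Exists v \<phi>) \<longleftrightarrow> (\<exists>a\<in>universe M. satisfies M (e(v := a)) \<phi>)"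

text \<open>
  A tuple of variables \<open>x\<close> is given by its finite set \<open>X\<close> of variables, and \<open>M\<^sup>x\<close> is the set of
  (extensional) functions from \<open>X\<close> to the universe.
\<close>

definition tuples :: "('f, 'r, 'a) fo_struct \<Rightarrow> nat set \<Rightarrow> (nat \<Rightarrow> 'a) set" where
  "tuples M X = (X \<rightarrow>\<^sub>E universe M)"

definition formulas :: "('f, 'r) language \<Rightarrow> nat set \<Rightarrow> 'p set \<Rightarrow> ('f, 'r, 'p) fm set" where
  "formulas L X A = {\<phi>. wf_fm L \<phi> \<and> fv_fm \<phi> \<subseteq> X \<and> pars_fm \<phi> \<subseteq> A}"

abbreviation formulas_over ::
  "('f, 'r) language \<Rightarrow> ('f, 'r, 'a) fo_struct \<Rightarrow> nat set \<Rightarrow> ('f, 'r, 'a) fm set" where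
  "formulas_over L M X \<equiv> formulas L X (universe M)"

definition equiv_in ::
  "('f, 'r, 'a) fo_struct \<Rightarrow> nat set \<Rightarrow> ('f, 'r, 'a) fm \<Rightarrow> ('f, 'r, 'a) fm \<Rightarrow> bool" where
  "equiv_in M X \<phi> \<psi> \<longleftrightarrow> (\<forall>a\<in>tuples M X. satisfies M a \<phi> \<longleftrightarrow> satisfies M a \<psi>)"

section \<open>Types and Keisler measures\<close>

definition types :: "('f, 'r) language \<Rightarrow> ('f, 'r, 'a) fo_struct \<Rightarrow> nat set
    \<Rightarrow> ('f, 'r, 'a) fm set set" where
  "types L M X = {p. p \<subseteq> formulas_over L M X \<and>
     (\<forall>q. finite q \<and> q \<subseteq> p \<longrightarrow> (\<exists>a\<in>tuples M X. \<forall>\<phi>\<in>q. satisfies M a \<phi>)) \<and>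
     (\<forall>\<phi>\<in>formulas_over L M X. \<phi> \<in> p \<or> Neg \<phi> \<in> p)}"

definition tp :: "('f, 'r) language \<Rightarrow> ('f, 'r, 'a) fo_struct \<Rightarrow> nat set
    \<Rightarrow> (nat \<Rightarrow> 'a) \<Rightarrow> ('f, 'r, 'a) fm set" where
  "tp L M X a = {\<phi> \<in> formulas_over L M X. satisfies M a \<phi>}"

definition type_cyl :: "('f, 'r) language \<Rightarrow> ('f, 'r, 'a) fo_struct \<Rightarrow> nat set
    \<Rightarrow> ('f, 'r, 'a) fm \<Rightarrow> ('f, 'r, 'a) fm set set" where
  "type_cyl L M X \<phi> = {p \<in> types L M X. \<phi> \<in> p}"

definition type_space :: "('f, 'r) language \<Rightarrow> ('f, 'r, 'a) fo_struct \<Rightarrow> nat set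
    \<Rightarrow> ('f, 'r, 'a) fm set topology" where
  "type_space L M X = topology_generated_by (type_cyl L M X ` formulas_over L M X)"

text \<open>
  A function on formulas modulo equivalence in \<open>M\<close> is represented as a function on formulas that
  is invariant under equivalence in \<open>M\<close>. It is extensional (equal to \<open>undefined\<close> outside
  the relevant formulas), so that equality of measures is equality of functions.
\<close>

definition keisler_measures :: "('f, 'r) language \<Rightarrow> ('f, 'r, 'a) fo_struct \<Rightarrow> nat set
    \<Rightarrow> (('f, 'r, 'a) fm \<Rightarrow> real) set" where
  "keisler_measures L M X = {\<mu> \<in> extensional (formulas_over L M X).
     (\<forall>\<phi>\<in>formulas_over L M X. \<forall>\<psi>\<in>formulas_over L M X. equiv_in M X \<phi> \<psi> \<longrightarrow> \<mu> \<phi> = \<mu> \<psi>) \<and>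
     (\<forall>\<phi>\<in>formulas_over L M X. 0 \<le> \<mu> \<phi>) \<and>
     \<mu> Verum = 1 \<and>
     (\<forall>\<phi>\<in>formulas_over L M X. \<forall>\<psi>\<in>formulas_over L M X.
        equiv_in M X (Conj \<phi> \<psi>) Falsum \<longrightarrow> \<mu> (Disj \<phi> \<psi>) = \<mu> \<phi> + \<mu> \<psi>)}"

definition dirac :: "('f, 'r) language \<Rightarrow> ('f, 'r, 'a) fo_struct \<Rightarrow> nat set
    \<Rightarrow> ('f, 'r, 'a) fm set \<Rightarrow> ('f, 'r, 'a) fm \<Rightarrow> real" where
  "dirac L M X p = (\<lambda>\<phi>\<in>formulas_over L M X. if \<phi> \<in> p then 1 else 0)"

definition conv_measures :: "('f, 'r) language \<Rightarrow> ('f, 'r, 'a) fo_struct \<Rightarrow> nat set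
    \<Rightarrow> (('f, 'r, 'a) fm \<Rightarrow> real) set" where
  "conv_measures L M X =
     {(\<lambda>\<phi>\<in>formulas_over L M X. \<Sum>k=1..n. r k * dirac L M X (tp L M X (a k)) \<phi>) | (n::nat) r a.
        n \<ge> 1 \<and> (\<forall>k\<in>{1..n}. a k \<in> tuples M X \<and> 0 < r k) \<and> (\<Sum>k=1..n. r k) = 1}"

section \<open>Definability and the Morley product\<close>

definition is_fiber_map :: "('f, 'r) language \<Rightarrow> ('f, 'r, 'a) fo_struct \<Rightarrow> nat set
    \<Rightarrow> (('f, 'r, 'a) fm \<Rightarrow> real) \<Rightarrow> ('f, 'r, 'a) fm \<Rightarrow> (('f, 'r, 'a) fm set \<Rightarrow> real) \<Rightarrow> bool" where
  "is_fiber_map L M Y \<mu> \<phi> F \<longleftrightarrow>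
     F \<in> extensional (types L M Y) \<and>
     continuous_map (type_space L M Y) (top_of_set {0..1}) F \<and>
     (\<forall>b\<in>tuples M Y. F (tp L M Y b) = \<mu> (inst_fm Y b \<phi>))"

definition definable :: "('f, 'r) language \<Rightarrow> ('f, 'r, 'a) fo_struct \<Rightarrow> nat set
    \<Rightarrow> (('f, 'r, 'a) fm \<Rightarrow> real) \<Rightarrow> bool" where
  "definable L M X \<mu> \<longleftrightarrow>
     (\<forall>Y. finite Y \<and> X \<inter> Y = {} \<longrightarrow>
       (\<forall>\<phi>\<in>formulas L (X \<union> Y) {}. \<exists>F. is_fiber_map L M Y \<mu> \<phi> F))"

definition fiber_map :: "('f, 'r) language \<Rightarrow> ('f, 'r, 'a) fo_struct \<Rightarrow> nat set
    \<Rightarrow> (('f, 'r, 'a) fm \<Rightarrow> real) \<Rightarrow> ('f, 'r, 'a) fm \<Rightarrow> ('f, 'r, 'a) fm set \<Rightarrow> real" where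
  "fiber_map L M Y \<mu> \<phi> = (THE F. is_fiber_map L M Y \<mu> \<phi> F)"

definition is_regular_borel_prob :: "'b topology \<Rightarrow> 'b measure \<Rightarrow> bool" where
  "is_regular_borel_prob T N \<longleftrightarrow>
     sets N = sets (sigma (topspace T) {U. openin T U}) \<and>
     prob_space N \<and>
     (\<forall>A\<in>sets N.
        emeasure N A = (SUP K\<in>{K. compactin T K \<and> K \<subseteq> A}. emeasure N K) \<and>
        emeasure N A = (INF U\<in>{U. openin T U \<and> A \<subseteq> U}. emeasure N U))"

definition borel_extension :: "('f, 'r) language \<Rightarrow> ('f, 'r, 'a) fo_struct \<Rightarrow> nat set
    \<Rightarrow> (('f, 'r, 'a) fm \<Rightarrow> real) \<Rightarrow> ('f, 'r, 'a) fm set measure" where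
  "borel_extension L M Y \<nu> = (THE N. is_regular_borel_prob (type_space L M Y) N \<and>
     (\<forall>\<psi>\<in>formulas_over L M Y. measure N (type_cyl L M Y \<psi>) = \<nu> \<psi>))"

text \<open>Meant for disjoint \<open>X\<close>, \<open>Y\<close> and definable \<open>\<mu>\<close>, in which case both descriptions above denote.\<close>

definition morley_product :: "('f, 'r) language \<Rightarrow> ('f, 'r, 'a) fo_struct \<Rightarrow> nat set \<Rightarrow> nat set
    \<Rightarrow> (('f, 'r, 'a) fm \<Rightarrow> real) \<Rightarrow> (('f, 'r, 'a) fm \<Rightarrow> real) \<Rightarrow> ('f, 'r, 'a) fm \<Rightarrow> real" where
  "morley_product L M X Y \<mu> \<nu> =
     (\<lambda>\<phi>\<in>formulas_over L M (X \<union> Y). \<integral>p. fiber_map L M Y \<mu> \<phi> p \<partial>borel_extension L M Y \<nu>)"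

section \<open>Ultraproducts and pseudo-finite measures\<close>

definition nonprincipal_ultrafilter :: "'i filter \<Rightarrow> bool" where
  "nonprincipal_ultrafilter D \<longleftrightarrow> D \<noteq> bot \<and>
     (\<forall>P. eventually P D \<or> eventually (\<lambda>i. \<not> P i) D) \<and>
     (\<forall>j. \<not> eventually (\<lambda>i. i = j) D)"

definition ultra_rel :: "'i filter \<Rightarrow> ('i \<Rightarrow> ('f, 'r, 'a) fo_struct) \<Rightarrow> (('i \<Rightarrow> 'a) \<times> ('i \<Rightarrow> 'a)) set" where
  "ultra_rel D M = {(g, h). g \<in> (\<Pi> i\<in>UNIV. universe (M i)) \<and> h \<in> (\<Pi> i\<in>UNIV. universe (M i)) \<and>
     eventually (\<lambda>i. g i = h i) D}"

definition rep :: "('i \<Rightarrow> 'a) set \<Rightarrow> 'i \<Rightarrow> 'a" where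
  "rep B = (SOME g. g \<in> B)"

definition ultraproduct :: "'i filter \<Rightarrow> ('i \<Rightarrow> ('f, 'r, 'a) fo_struct)
    \<Rightarrow> ('f, 'r, ('i \<Rightarrow> 'a) set) fo_struct" where
  "ultraproduct D M = \<lparr>
     universe = (\<Pi> i\<in>UNIV. universe (M i)) // ultra_rel D M,
     fun_interp = (\<lambda>f Bs. ultra_rel D M `` {\<lambda>i. fun_interp (M i) f (map (\<lambda>B. rep B i) Bs)}),
     rel_interp = (\<lambda>R Bs. eventually (\<lambda>i. rel_interp (M i) R (map (\<lambda>B. rep B i) Bs)) D)\<rparr>"

text \<open>
  Replacing each parameter \<open>B\<close> of \<open>\<phi>(x,b)\<close> by \<open>rep B i\<close> gives \<open>\<phi>(x,b(i))\<close>.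
\<close>

definition ultralimit :: "('f, 'r) language \<Rightarrow> 'i filter \<Rightarrow> ('i \<Rightarrow> ('f, 'r, 'a) fo_struct) \<Rightarrow> nat set
    \<Rightarrow> ('i \<Rightarrow> ('f, 'r, 'a) fm \<Rightarrow> real) \<Rightarrow> ('f, 'r, ('i \<Rightarrow> 'a) set) fm \<Rightarrow> real" where
  "ultralimit L D M X \<mu>s =
     (\<lambda>\<phi>\<in>formulas_over L (ultraproduct D M) X. Lim D (\<lambda>i. \<mu>s i (map_fm (\<lambda>B. rep B i) \<phi>)))"

definition pf_witness :: "('f, 'r) language \<Rightarrow> 'i filter \<Rightarrow> ('i \<Rightarrow> ('f, 'r, 'a) fo_struct) \<Rightarrow> nat set
    \<Rightarrow> (('f, 'r, ('i \<Rightarrow> 'a) set) fm \<Rightarrow> real) \<Rightarrow> ('i \<Rightarrow> ('f, 'r, 'a) fm \<Rightarrow> real) \<Rightarrow> bool" where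
  "pf_witness L D M X \<mu> \<mu>s \<longleftrightarrow>
     (\<forall>i. \<mu>s i \<in> conv_measures L (M i) X) \<and> \<mu> = ultralimit L D M X \<mu>s"

definition pseudo_finite :: "('f, 'r) language \<Rightarrow> 'i filter \<Rightarrow> ('i \<Rightarrow> ('f, 'r, 'a) fo_struct) \<Rightarrow> nat set
    \<Rightarrow> (('f, 'r, ('i \<Rightarrow> 'a) set) fm \<Rightarrow> real) \<Rightarrow> bool" where
  "pseudo_finite L D M X \<mu> \<longleftrightarrow> (\<exists>\<mu>s. pf_witness L D M X \<mu> \<mu>s)"

text \<open>The definite description expresses that the result is the same for all choices of witnesses.\<close>

definition pf_product :: "('f, 'r) language \<Rightarrow> 'i filter \<Rightarrow> ('i \<Rightarrow> ('f, 'r, 'a) fo_struct)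
    \<Rightarrow> nat set \<Rightarrow> nat set
    \<Rightarrow> (('f, 'r, ('i \<Rightarrow> 'a) set) fm \<Rightarrow> real) \<Rightarrow> (('f, 'r, ('i \<Rightarrow> 'a) set) fm \<Rightarrow> real)
    \<Rightarrow> ('f, 'r, ('i \<Rightarrow> 'a) set) fm \<Rightarrow> real" where
  "pf_product L D M X Y \<mu> \<nu> = (THE \<rho>. \<exists>\<mu>s \<nu>s.
     pf_witness L D M X \<mu> \<mu>s \<and> pf_witness L D M Y \<nu> \<nu>s \<and>
     \<rho> = ultralimit L D M (X \<union> Y) (\<lambda>i. morley_product L (M i) X Y (\<mu>s i) (\<nu>s i)))"

end

theory Submission
  imports Defs
begin

text \<open>
  Why the two products agree. For a formula \<open>\<phi>(x,y,c)\<close> over the ultraproduct, the Morley product is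
  the integral against \<open>\<nu>\<close> of the fiber map \<open>F\<close>, which is continuous because \<open>\<mu>\<close> is definable.
  Continuous functions on the type space, which is compact with a base of clopen cylinders, are uniform
  limits of step functions built from formulas \<open>\<theta> j\<close>
  (\<open>step_approx\<close>). Hence for small \<open>e\<close> there are finitely many formulas and weights such that
  \<open>\<mu>(\<phi>(x,b,c))\<close> is within \<open>e\<close> of \<open>\<Sum> w j [\<theta> j holds at b]\<close> for all tuples \<open>b\<close> of the ultraproduct.

  This is a statement about tuples and formulas, and it descends to the factors: for almost all \<open>i\<close>,
  the same formulas and weights approximate \<open>\<mu>\<^sub>i(\<phi>(x,b,c(i)))\<close> within \<open>2e\<close> for all tuples \<open>b\<close> of
  \<open>M\<^sub>i\<close>. Otherwise the ultraproduct of counterexamples would be a counterexample, by the theorem of Los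
  and because \<open>\<mu>\<close> is the ultralimit of the \<open>\<mu>\<^sub>i\<close> (\<open>step_approx_transfer\<close>). It is here that definability
  enters: the uniformity in \<open>b\<close> comes from the step functions.

  Such an approximation determines the Morley product up to the same error as a combination
  \<open>\<Sum> w j \<nu>(\<theta> j)\<close>, over the ultraproduct and over each factor alike (\<open>morley_product_approx\<close>); and
  \<open>\<Sum> w j \<nu>\<^sub>i(\<theta> j)\<close> converges to \<open>\<Sum> w j \<nu>(\<theta> j)\<close> along the ultrafilter. So
  \<open>(\<mu>\<^sub>i \<otimes> \<nu>\<^sub>i)(\<phi>(x,y,c(i)))\<close> converges to \<open>(\<mu> \<otimes> \<nu>)(\<phi>(x,y,c))\<close> (\<open>tendsto_morley_product\<close>).

  Two foundational facts are needed. The measure on the type space that the Morley product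
  integrates against exists and is unique: compactness turns a finitely additive measure on clopen
  sets into a regular Borel measure. And definability, a condition on formulas without parameters,
  gives fiber maps for formulas with parameters (\<open>definable_fiber_map\<close>).
\<close>

section \<open>Regular Borel measures from finitely additive measures on clopen sets\<close>

lemma ennreal_less_add_pos: "x < \<top> \<Longrightarrow> 0 < e \<Longrightarrow> x < x + ennreal e" for x :: ennreal
  by (cases x) (auto simp: ennreal_plus[symmetric] ennreal_less_iff simp del: ennreal_plus)

text \<open>
  The type space is compact and has an algebra of clopen sets as a base. A finitely additive
  probability measure on this algebra extends uniquely to a regular Borel measure. The base may be
  uncountable, so the Borel sets can be strictly more than the \<open>\<sigma>\<close>-algebra generated by the
  clopen sets, and the extension theorem for premeasures on an algebra does not reach all of them.
  The extension is built as in the Riesz representation theorem: open sets are measured from inside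
  by clopen sets, arbitrary sets from outside by open sets.
\<close>

locale clopen_base = algebra "topspace T" A
  for T :: "'b topology" and A :: "'b set set" +
  assumes compact: "compact_space T"
    and openin_base: "a \<in> A \<Longrightarrow> openin T a"
    and base: "openin T U \<Longrightarrow> p \<in> U \<Longrightarrow> \<exists>a\<in>A. p \<in> a \<and> a \<subseteq> U"
begin

lemma compactin_base: "a \<in> A \<Longrightarrow> compactin T a"
proof (rule closedin_compact_space[OF compact])
  assume a: "a \<in> A"
  then have "openin T (topspace T - a)" by (intro openin_base) auto
  then show "closedin T a" using a sets_into_space by (auto simp: closedin_def)
qed

text \<open>
  Members of a finite subcover that were chosen inside the same \<open>U j\<close> are merged into one set
  \<open>B j\<close>; in this form the cover can be compared termwise with the family \<open>U\<close>.
\<close>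

lemma refine_cover:
  assumes K: "compactin T K" and U: "\<And>i. i \<in> I \<Longrightarrow> openin T (U i)" and sub: "K \<subseteq> (\<Union>i\<in>I. U i)"
  obtains J B where "finite J" "J \<subseteq> I" "\<And>j. j \<in> J \<Longrightarrow> B j \<in> A" "\<And>j. j \<in> J \<Longrightarrow> B j \<subseteq> U j"
    "K \<subseteq> (\<Union>j\<in>J. B j)"
proof -
  define C where "C = {a\<in>A. \<exists>i\<in>I. a \<subseteq> U i}"
  have "K \<subseteq> \<Union>C"
  proof
    fix p assume "p \<in> K"
    then obtain i where i: "i \<in> I" "p \<in> U i" using sub by auto
    from base[OF U[OF i(1)] i(2)] show "p \<in> \<Union>C" using i by (auto simp: C_def)
  qed
  moreover have "\<And>c. c \<in> C \<Longrightarrow> openin T c" by (auto simp: C_def openin_base)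
  ultimately obtain F where F: "finite F" "F \<subseteq> C" "K \<subseteq> \<Union>F"
    using compactinD[OF K, of C] by auto
  have "\<forall>a\<in>F. \<exists>i. i \<in> I \<and> a \<subseteq> U i" using F(2) by (auto simp: C_def)
  then obtain i where i: "\<And>a. a \<in> F \<Longrightarrow> i a \<in> I \<and> a \<subseteq> U (i a)" by metis
  show ?thesis
  proof (rule that[of "i ` F" "\<lambda>j. \<Union>{a\<in>F. i a = j}"])
    show "\<Union>{a\<in>F. i a = j} \<in> A" for j
      using F by (intro finite_Union) (auto simp: C_def)
    show "K \<subseteq> (\<Union>j\<in>i ` F. \<Union>{a\<in>F. i a = j})" using F(3) by blast
    show "\<Union>{a\<in>F. i a = j} \<subseteq> U j" for j using i by blast
  qed (use F i in auto)
qed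

lemma clopen_separation:
  assumes K: "compactin T K" and U: "openin T U" "K \<subseteq> U"
  obtains a where "a \<in> A" "K \<subseteq> a" "a \<subseteq> U"
proof -
  obtain J :: "nat set" and B where B: "finite J" "\<And>j. j \<in> J \<Longrightarrow> B j \<in> A"
    "\<And>j. j \<in> J \<Longrightarrow> B j \<subseteq> U" "K \<subseteq> (\<Union>j\<in>J. B j)"
    by (rule refine_cover[OF K, of UNIV "\<lambda>_. U"]) (use U in auto)
  then show ?thesis using that[of "\<Union>j\<in>J. B j"] by auto
qed

end

locale clopen_premeasure = clopen_base T A
  for T :: "'b topology" and A :: "'b set set" +
  fixes m :: "'b set \<Rightarrow> ennreal"
  assumes pos: "positive A m" and add: "additive A m" and total: "m (topspace T) = 1"
begin

definition inner_content :: "'b set \<Rightarrow> ennreal" where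
  "inner_content U = (SUP a\<in>{a\<in>A. a \<subseteq> U}. m a)"

definition outer :: "'b set \<Rightarrow> ennreal" where
  "outer E = (INF U\<in>{U. openin T U \<and> E \<subseteq> U}. inner_content U)"

lemma m_mono: "a \<in> A \<Longrightarrow> b \<in> A \<Longrightarrow> a \<subseteq> b \<Longrightarrow> m a \<le> m b"
  using additive_increasing[OF pos add] by (auto simp: increasing_def)

lemma m_le_inner_content: "a \<in> A \<Longrightarrow> a \<subseteq> U \<Longrightarrow> m a \<le> inner_content U"
  unfolding inner_content_def by (auto intro: SUP_upper)

lemma content_base: "a \<in> A \<Longrightarrow> inner_content a = m a"
  unfolding inner_content_def by (rule antisym) (auto intro: SUP_least m_mono SUP_upper)

lemma content_mono: "U \<subseteq> V \<Longrightarrow> inner_content U \<le> inner_content V"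
  unfolding inner_content_def by (rule SUP_subset_mono) auto

lemma content_le_1: "U \<subseteq> topspace T \<Longrightarrow> inner_content U \<le> 1"
  using content_mono[of U "topspace T"] content_base[OF top] total by simp

text \<open>
  This is where compactness replaces countable additivity: a clopen subset of a countable union of
  open sets is already covered by finitely many clopen sets, each inside one member of the union.
\<close>

lemma content_subadditive:
  fixes U :: "nat \<Rightarrow> 'b set"
  assumes U: "\<And>n. openin T (U n)"
  shows "inner_content (\<Union>n. U n) \<le> (\<Sum>n. inner_content (U n))"
  unfolding inner_content_def[of "\<Union>n. U n"]
proof (rule SUP_least, clarify)
  fix a assume a: "a \<in> A" "a \<subseteq> (\<Union>n. U n)"
  from refine_cover[of a UNIV U] obtain J B where JB: "finite J" "\<And>j. j \<in> J \<Longrightarrow> B j \<in> A"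
    "\<And>j. j \<in> J \<Longrightarrow> B j \<subseteq> U j" "a \<subseteq> (\<Union>j\<in>J. B j)"
    using compactin_base[OF a(1)] U a(2) by metis
  have "m a \<le> m (\<Union>j\<in>J. B j)" using a JB by (intro m_mono) auto
  also have "\<dots> \<le> (\<Sum>j\<in>J. m (B j))" using JB by (intro subadditive[OF pos add]) auto
  also have "\<dots> \<le> (\<Sum>j\<in>J. inner_content (U j))" using JB by (intro sum_mono m_le_inner_content) auto
  also have "\<dots> \<le> (\<Sum>n. inner_content (U n))" using JB(1) by (intro sum_le_suminf) auto
  finally show "m a \<le> (\<Sum>n. inner_content (U n))" .
qed

lemma outer_open: "openin T U \<Longrightarrow> outer U = inner_content U"
  unfolding outer_def by (rule antisym) (auto intro: INF_lower INF_greatest content_mono)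

lemma outer_mono: "E \<subseteq> F \<Longrightarrow> outer E \<le> outer F"
  unfolding outer_def by (rule INF_superset_mono) auto

lemma outer_le: "openin T U \<Longrightarrow> E \<subseteq> U \<Longrightarrow> outer E \<le> inner_content U"
  unfolding outer_def by (auto intro: INF_lower)

lemma outer_le_1: "E \<subseteq> topspace T \<Longrightarrow> outer E \<le> 1"
  using outer_le[OF openin_topspace] content_le_1[OF subset_refl] by (meson order_trans)

lemma outer_measure_space_outer: "outer_measure_space (Pow (topspace T)) outer"
  unfolding outer_measure_space_def
proof (intro conjI)
  show "positive (Pow (topspace T)) outer"
    using outer_open[OF openin_empty] content_base[OF empty_sets] pos by (simp add: positive_def)
  show "increasing (Pow (topspace T)) outer" unfolding increasing_def by (intro ballI impI outer_mono)
  show "countably_subadditive (Pow (topspace T)) outer"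
  proof (unfold countably_subadditive_def, intro allI impI)
    fix E :: "nat \<Rightarrow> 'b set" assume E: "range E \<subseteq> Pow (topspace T)"
    show "outer (\<Union>i. E i) \<le> (\<Sum>i. outer (E i))"
    proof (rule ennreal_le_epsilon)
      fix e :: real assume e: "0 < e"
      \<comment> \<open>The errors for the single sets are \<open>e/2, e/4, \<dots>\<close>, with sum \<open>e\<close>.\<close>
      have "\<exists>U. openin T U \<and> E n \<subseteq> U \<and> inner_content U < outer (E n) + ennreal (e * (1/2) ^ Suc n)" for n
      proof -
        have "outer (E n) \<le> 1" using outer_le_1[of "E n"] E by (auto simp: image_subset_iff)
        then have "outer (E n) < \<top>" by (rule le_less_trans) simp
        then have "outer (E n) < outer (E n) + ennreal (e * (1/2) ^ Suc n)"
          using e by (intro ennreal_less_add_pos) auto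
        from this[unfolded outer_def[of "E n"], unfolded INF_less_iff] show ?thesis
          unfolding outer_def by auto
      qed
      then obtain U where U: "\<And>n. openin T (U n)" "\<And>n. E n \<subseteq> U n"
        "\<And>n. inner_content (U n) < outer (E n) + ennreal (e * (1/2) ^ Suc n)" by metis
      have "outer (\<Union>i. E i) \<le> inner_content (\<Union>i. U i)" using U by (intro outer_le) auto
      also have "\<dots> \<le> (\<Sum>n. inner_content (U n))" by (intro content_subadditive U)
      also have "\<dots> \<le> (\<Sum>n. outer (E n) + ennreal (e * (1/2) ^ Suc n))"
        using U(3) by (intro suminf_le) (auto intro: less_imp_le)
      also have "\<dots> = (\<Sum>n. outer (E n)) + (\<Sum>n. ennreal (e * (1/2) ^ Suc n))"
        by (intro suminf_add[symmetric]) auto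
      also have "(\<Sum>n. ennreal (e * (1/2) ^ Suc n)) = ennreal e"
        using sums_mult[OF power_half_series, of e] e
        by (subst suminf_ennreal_eq) auto
      finally show "outer (\<Union>i. E i) \<le> (\<Sum>i. outer (E i)) + ennreal e" .
    qed
  qed
qed

lemma content_approx:
  assumes "0 < e" "U \<subseteq> topspace T"
  obtains a where "a \<in> A" "a \<subseteq> U" "inner_content U < m a + ennreal e"
proof -
  have fin: "inner_content U \<le> 1" using content_le_1 assms by auto
  show ?thesis
  proof (rule ccontr)
    assume "\<not> thesis"
    then have *: "\<And>a. a \<in> A \<Longrightarrow> a \<subseteq> U \<Longrightarrow> m a + ennreal e \<le> inner_content U"
      using that by (meson not_le)
    have "inner_content U + ennreal e = (SUP a\<in>{a\<in>A. a \<subseteq> U}. m a + ennreal e)"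
      unfolding inner_content_def by (intro ennreal_SUP_add_left[symmetric]) auto
    also have "\<dots> \<le> inner_content U" using * by (auto intro: SUP_least)
    also have "inner_content U < inner_content U + ennreal e"
      using fin assms(1) by (intro ennreal_less_add_pos) (auto intro: le_less_trans)
    finally show False by simp
  qed
qed

text \<open>
  Given an open \<open>V \<supseteq> E\<close>, approximate \<open>V \<inter> U\<close> from inside by a clopen set \<open>a\<close>. Because \<open>a\<close> is also
  closed, \<open>V - a\<close> is open, it contains \<open>E - U\<close>, and it can be approximated from inside by a clopen
  \<open>b\<close>; finite additivity on the disjoint sets \<open>a\<close>, \<open>b\<close> gives the splitting inequality.
\<close>

lemma open_in_lambda_system:
  assumes U: "openin T U"
  shows "U \<in> lambda_system (topspace T) (Pow (topspace T)) outer"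
proof -
  interpret P: sigma_algebra "topspace T" "Pow (topspace T)" by (rule sigma_algebra_Pow)
  have sub: "subadditive (Pow (topspace T)) outer"
    using outer_measure_space_outer
    by (auto simp: outer_measure_space_def intro!: P.countably_subadditive_subadditive)
  have "outer (E \<inter> U) + outer (E - U) = outer E" if E: "E \<subseteq> topspace T" for E
  proof (rule antisym)
    have "outer ((E \<inter> U) \<union> (E - U)) \<le> outer (E \<inter> U) + outer (E - U)"
      using E by (intro subadditiveD[OF sub]) auto
    then show "outer E \<le> outer (E \<inter> U) + outer (E - U)" by (simp add: Int_Diff_Un)
    show "outer (E \<inter> U) + outer (E - U) \<le> outer E"
      unfolding outer_def[of E]
    proof (rule INF_greatest, clarify)
      fix V assume V: "openin T V" "E \<subseteq> V"
      show "outer (E \<inter> U) + outer (E - U) \<le> inner_content V"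
      proof (rule ennreal_le_epsilon)
        fix e :: real assume e: "0 < e"
        have VU: "openin T (V \<inter> U)" using U V by auto
        obtain a where a: "a \<in> A" "a \<subseteq> V \<inter> U" "inner_content (V \<inter> U) < m a + ennreal (e/2)"
          using content_approx[of "e/2" "V \<inter> U"] e openin_subset[OF VU] by auto
        have Va: "openin T (V - a)"
        proof -
          have "V - a = V \<inter> (topspace T - a)" using openin_subset[OF V(1)] by auto
          then show ?thesis using V(1) openin_base[of "topspace T - a"] a(1) by auto
        qed
        obtain b where b: "b \<in> A" "b \<subseteq> V - a" "inner_content (V - a) < m b + ennreal (e/2)"
          using content_approx[of "e/2" "V - a"] e openin_subset[OF Va] by auto
        have ab: "a \<inter> b = {}" using b(2) by auto
        have "outer (E \<inter> U) + outer (E - U) \<le> inner_content (V \<inter> U) + inner_content (V - a)"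
          using V(2) a(2) by (intro add_mono outer_le VU Va) auto
        also have "\<dots> \<le> (m a + ennreal (e/2)) + (m b + ennreal (e/2))"
          using a(3) b(3) by (intro add_mono less_imp_le)
        also have "\<dots> = (m a + m b) + (ennreal (e/2) + ennreal (e/2))" by (simp add: ac_simps)
        also have "ennreal (e/2) + ennreal (e/2) = ennreal e"
          using e by (simp del: ennreal_plus add: ennreal_plus[symmetric])
        also have "m a + m b = m (a \<union> b)" using add a(1) b(1) ab by (simp add: additive_def)
        also have "\<dots> \<le> inner_content V" using a b by (intro m_le_inner_content) auto
        finally show "outer (E \<inter> U) + outer (E - U) \<le> inner_content V + ennreal e" by simp
      qed
    qed
  qed
  then show ?thesis using openin_subset[OF U] by (auto simp: P.lambda_system_eq)
qed

definition borel_measure :: "'b measure" where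
  "borel_measure = measure_of (topspace T) {U. openin T U} outer"

lemma
  shows sets_borel_measure: "sets borel_measure = sets (sigma (topspace T) {U. openin T U})"
    and space_borel_measure: "space borel_measure = topspace T"
    and emeasure_borel_measure: "E \<in> sets borel_measure \<Longrightarrow> emeasure borel_measure E = outer E"
proof -
  have sub: "{U. openin T U} \<subseteq> Pow (topspace T)" using openin_subset by auto
  then show sets: "sets borel_measure = sets (sigma (topspace T) {U. openin T U})"
    and "space borel_measure = topspace T"
    by (auto simp: borel_measure_def space_measure_of_conv)
  interpret P: sigma_algebra "topspace T" "Pow (topspace T)" by (rule sigma_algebra_Pow)
  let ?L = "lambda_system (topspace T) (Pow (topspace T)) outer"
  have L: "measure_space (topspace T) ?L outer"
    by (rule P.caratheodory_lemma[OF outer_measure_space_outer])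
  interpret L: sigma_algebra "topspace T" ?L using L by (simp add: measure_space_def)
  have "sigma_sets (topspace T) {U. openin T U} \<subseteq> ?L"
    by (intro L.sigma_sets_subset) (auto intro: open_in_lambda_system)
  then have "measure_space (topspace T) (sigma_sets (topspace T) {U. openin T U}) outer"
    by (intro measure_down[OF L] sigma_algebra_sigma_sets sub)
  then have "positive (sets borel_measure) outer" "countably_additive (sets borel_measure) outer"
    using sub by (auto simp: borel_measure_def measure_space_def)
  then show "E \<in> sets borel_measure \<Longrightarrow> emeasure borel_measure E = outer E"
    by (intro emeasure_measure_of[OF borel_measure_def sub])
qed

lemma openin_sets: "openin T U \<Longrightarrow> U \<in> sets borel_measure"
  using openin_subset[of T] by (auto simp: sets_borel_measure)

lemma prob_space_borel_measure: "prob_space borel_measure"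
  by (rule prob_spaceI)
    (simp add: space_borel_measure emeasure_borel_measure openin_sets outer_open content_base[OF top] total)

lemma emeasure_borel_measure_base: "a \<in> A \<Longrightarrow> emeasure borel_measure a = m a"
  by (simp add: emeasure_borel_measure openin_sets openin_base outer_open content_base)

lemma borel_measure_outer_regular:
  assumes E: "E \<in> sets borel_measure"
  shows "emeasure borel_measure E = (INF U\<in>{U. openin T U \<and> E \<subseteq> U}. emeasure borel_measure U)"
  unfolding emeasure_borel_measure[OF E] outer_def
  by (rule INF_cong) (auto simp: emeasure_borel_measure openin_sets outer_open)

text \<open>
  Inner regularity at \<open>E\<close> is outer regularity at the complement, since the measure is finite and
  closed sets are compact.
\<close>

lemma borel_measure_inner_regular:
  assumes E: "E \<in> sets borel_measure"
  shows "emeasure borel_measure E = (SUP K\<in>{K. compactin T K \<and> K \<subseteq> E}. emeasure borel_measure K)"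
proof (rule antisym)
  interpret prob_space borel_measure by (rule prob_space_borel_measure)
  show "(SUP K\<in>{K. compactin T K \<and> K \<subseteq> E}. emeasure borel_measure K) \<le> emeasure borel_measure E"
    using emeasure_mono[OF _ E] by (intro SUP_least) simp
  show "emeasure borel_measure E \<le> (SUP K\<in>{K. compactin T K \<and> K \<subseteq> E}. emeasure borel_measure K)"
  proof (rule ennreal_le_epsilon)
    fix e :: real assume e: "0 < e"
    let ?C = "topspace T - E"
    have C: "?C \<in> sets borel_measure" using sets.compl_sets[OF E] by (simp add: space_borel_measure)
    have "emeasure borel_measure ?C < emeasure borel_measure ?C + ennreal e"
      using e by (intro ennreal_less_add_pos) (auto simp: emeasure_eq_measure)
    from this[unfolded borel_measure_outer_regular[OF C], unfolded INF_less_iff]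
    obtain U where U: "openin T U" "?C \<subseteq> U"
      "emeasure borel_measure U < emeasure borel_measure ?C + ennreal e"
      unfolding borel_measure_outer_regular[OF C, symmetric] by auto
    let ?K = "topspace T - U"
    have K: "closedin T ?K" using U by auto
    have "prob U < prob ?C + e"
      using U(3) e by (simp add: emeasure_eq_measure)
        (simp del: ennreal_plus add: ennreal_plus[symmetric] ennreal_less_iff)
    moreover have "prob ?C = 1 - prob E" using prob_compl[OF E] by (simp add: space_borel_measure)
    moreover have "prob ?K = 1 - prob U"
      using prob_compl[OF openin_sets[OF U(1)]] by (simp add: space_borel_measure)
    ultimately have "prob E \<le> prob ?K + e" by simp
    then have "emeasure borel_measure E \<le> emeasure borel_measure ?K + ennreal e"
      using e by (simp del: ennreal_plus add: emeasure_eq_measure ennreal_plus[symmetric])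
    also have "emeasure borel_measure ?K \<le> (SUP K\<in>{K. compactin T K \<and> K \<subseteq> E}. emeasure borel_measure K)"
      using U(2) sets.sets_into_space[OF E] K closedin_compact_space[OF compact K]
      by (intro SUP_upper) (auto simp: space_borel_measure)
    finally show "emeasure borel_measure E
      \<le> (SUP K\<in>{K. compactin T K \<and> K \<subseteq> E}. emeasure borel_measure K) + ennreal e"
      by simp
  qed
qed

lemma regular_borel_measure: "is_regular_borel_prob T borel_measure"
  unfolding is_regular_borel_prob_def
  using sets_borel_measure prob_space_borel_measure borel_measure_inner_regular
    borel_measure_outer_regular by blast

text \<open>
  Inner regularity determines the measure of an open set from compact subsets, and each of these
  lies in a clopen set inside the open set; outer regularity then determines all other values.
\<close>

lemma regular_extension_unique:
  assumes N: "is_regular_borel_prob T N" and ext: "\<And>a. a \<in> A \<Longrightarrow> emeasure N a = m a"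
  shows "N = borel_measure"
proof (rule measure_eqI)
  show sets: "sets N = sets borel_measure"
    using N by (simp add: is_regular_borel_prob_def sets_borel_measure)
  have "emeasure N U = outer U" if U: "openin T U" for U
  proof (rule antisym)
    have "emeasure N U = (SUP K\<in>{K. compactin T K \<and> K \<subseteq> U}. emeasure N K)"
      using N U openin_sets[OF U] sets by (simp add: is_regular_borel_prob_def)
    also have "\<dots> \<le> inner_content U"
    proof (rule SUP_least, clarify)
      fix K assume K: "compactin T K" "K \<subseteq> U"
      obtain a where a: "a \<in> A" "K \<subseteq> a" "a \<subseteq> U"
        using clopen_separation K U by blast
      have "emeasure N K \<le> emeasure N a"
        using a(2) sets openin_sets[OF openin_base[OF a(1)]] by (intro emeasure_mono) auto
      also have "\<dots> \<le> inner_content U" unfolding ext[OF a(1)] using a by (intro m_le_inner_content)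
      finally show "emeasure N K \<le> inner_content U" .
    qed
    finally show "emeasure N U \<le> outer U" by (simp add: outer_open U)
    show "outer U \<le> emeasure N U"
      unfolding outer_open[OF U] inner_content_def
    proof (rule SUP_least, clarify)
      fix a assume a: "a \<in> A" "a \<subseteq> U"
      then have "emeasure N a \<le> emeasure N U" using openin_sets[OF U] sets by (intro emeasure_mono) auto
      then show "m a \<le> emeasure N U" by (simp add: ext a)
    qed
  qed
  then have open_eq: "emeasure N U = emeasure borel_measure U" if "openin T U" for U
    using that by (simp add: emeasure_borel_measure openin_sets)
  fix E assume "E \<in> sets N"
  then have E: "E \<in> sets N" "E \<in> sets borel_measure" using sets by auto
  have "emeasure N E = (INF U\<in>{U. openin T U \<and> E \<subseteq> U}. emeasure N U)"
    using N E(1) unfolding is_regular_borel_prob_def by blast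
  also have "\<dots> = emeasure borel_measure E"
    unfolding borel_measure_outer_regular[OF E(2)] by (rule INF_cong) (auto simp: open_eq)
  finally show "emeasure N E = emeasure borel_measure E" .
qed

end

section \<open>Instantiating variables and changing parameters\<close>

lemma eval_tm_cong: "(\<And>v. v \<in> fv_tm t \<Longrightarrow> e v = e' v) \<Longrightarrow> eval_tm M e t = eval_tm M e' t"
proof (induction t)
  case (Fn f ts)
  then have "map (eval_tm M e) ts = map (eval_tm M e') ts" by (intro map_cong) auto
  then show ?case by (simp only: eval_tm.simps)
qed auto

lemma satisfies_cong:
  "(\<And>v. v \<in> fv_fm \<phi> \<Longrightarrow> e v = e' v) \<Longrightarrow> satisfies M e \<phi> \<longleftrightarrow> satisfies M e' \<phi>"
proof (induction \<phi> arbitrary: e e')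
  case (Equal s t)
  then show ?case using eval_tm_cong[of s e e' M] eval_tm_cong[of t e e' M] by auto
next
  case (Rel R ts)
  then have "map (eval_tm M e) ts = map (eval_tm M e') ts" by (intro map_cong eval_tm_cong) auto
  then show ?case by (simp only: satisfies.simps)
next
  case (Conj \<phi> \<psi>)
  have "satisfies M e \<phi> \<longleftrightarrow> satisfies M e' \<phi>" "satisfies M e \<psi> \<longleftrightarrow> satisfies M e' \<psi>"
    by (rule Conj.IH; use Conj.prems in simp)+
  then show ?case by simp
next
  case (Neg \<phi>)
  have "satisfies M e \<phi> \<longleftrightarrow> satisfies M e' \<phi>" by (rule Neg.IH) (use Neg.prems in simp)
  then show ?case by simp
next
  case (Exists v \<phi>)
  then have "satisfies M (e(v := a)) \<phi> \<longleftrightarrow> satisfies M (e'(v := a)) \<phi>" for a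
    by (intro Exists.IH) auto
  then show ?case by simp
qed simp

lemma eval_inst_tm:
  "eval_tm M e (inst_tm Y b t) = eval_tm M (\<lambda>v. if v \<in> Y then b v else e v) t"
  by (induction t) (auto simp: o_def cong: map_cong)

text \<open>
  Only parameters are substituted, never terms with variables, so no capture can occur.
\<close>

lemma satisfies_inst_fm:
  "satisfies M e (inst_fm Y b \<phi>) \<longleftrightarrow> satisfies M (\<lambda>v. if v \<in> Y then b v else e v) \<phi>"
proof (induction \<phi> arbitrary: Y e)
  case (Exists v \<phi>)
  have "(\<lambda>u. if u \<in> Y - {v} then b u else (e(v := a)) u) = (\<lambda>u. if u \<in> Y then b u else e u)(v := a)" for a
    by auto
  with Exists show ?case by simp
qed (auto simp: eval_inst_tm o_def)

lemma fv_inst_tm: "fv_tm (inst_tm Y b t) = fv_tm t - Y"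
  by (induction t) auto

lemma fv_inst_fm: "fv_fm (inst_fm Y b \<phi>) = fv_fm \<phi> - Y"
  by (induction \<phi> arbitrary: Y) (auto simp: fv_inst_tm)

lemma wf_inst_tm: "wf_tm L (inst_tm Y b t) \<longleftrightarrow> wf_tm L t"
  by (induction t) (auto simp: list_all_iff)

lemma wf_inst_fm: "wf_fm L (inst_fm Y b \<phi>) \<longleftrightarrow> wf_fm L \<phi>"
  by (induction \<phi> arbitrary: Y) (auto simp: wf_inst_tm list_all_iff)

lemma pars_inst_tm: "pars_tm (inst_tm Y b t) \<subseteq> pars_tm t \<union> b ` Y"
  by (induction t) auto

lemma pars_inst_fm: "pars_fm (inst_fm Y b \<phi>) \<subseteq> pars_fm \<phi> \<union> b ` Y"
proof (induction \<phi> arbitrary: Y)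
  case (Equal s t)
  then show ?case using pars_inst_tm[of Y b s] pars_inst_tm[of Y b t] by auto
next
  case (Rel R ts)
  then show ?case using pars_inst_tm[of Y b] by fastforce
next
  case (Conj \<phi> \<psi>)
  then show ?case using Conj.IH(1)[of Y] Conj.IH(2)[of Y] by auto
next
  case (Exists v \<phi>)
  then show ?case using Exists.IH[of "Y - {v}"] by auto
qed auto

lemma inst_fm_formulas:
  "\<phi> \<in> formulas L (X \<union> Y) A \<Longrightarrow> b ` Y \<subseteq> A \<Longrightarrow> inst_fm Y b \<phi> \<in> formulas L X A"
  using pars_inst_fm[of Y b \<phi>] unfolding formulas_def wf_inst_fm fv_inst_fm mem_Collect_eq by blast

lemma inst_fm_formulas_over:
  "\<phi> \<in> formulas_over L M (X \<union> Y) \<Longrightarrow> b \<in> tuples M Y \<Longrightarrow> inst_fm Y b \<phi> \<in> formulas_over L M X"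
  by (rule inst_fm_formulas) (auto simp: tuples_def)

lemma inst_tm_cong: "(\<And>v. v \<in> Y \<Longrightarrow> b v = b' v) \<Longrightarrow> inst_tm Y b t = inst_tm Y b' t"
  by (induction t) auto

lemma inst_fm_cong: "(\<And>v. v \<in> Y \<Longrightarrow> b v = b' v) \<Longrightarrow> inst_fm Y b \<phi> = inst_fm Y b' \<phi>"
proof (induction \<phi> arbitrary: Y)
  case (Exists v \<phi>)
  show ?case using Exists.IH[of "Y - {v}"] Exists.prems by simp
qed (auto intro: inst_tm_cong)

lemma map_inst_tm: "map_tm f (inst_tm Y b t) = inst_tm Y (f \<circ> b) (map_tm f t)"
  by (induction t) auto

lemma map_inst_fm: "map_fm f (inst_fm Y b \<phi>) = inst_fm Y (f \<circ> b) (map_fm f \<phi>)"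
  by (induction \<phi> arbitrary: Y) (auto simp: map_inst_tm)

lemma wf_map_tm: "wf_tm L (map_tm f t) \<longleftrightarrow> wf_tm L t"
  by (induction t) (auto simp: list_all_iff)

lemma wf_map_fm: "wf_fm L (map_fm f \<phi>) \<longleftrightarrow> wf_fm L \<phi>"
  by (induction \<phi>) (auto simp: wf_map_tm list_all_iff)

lemma fv_map_tm: "fv_tm (map_tm f t) = fv_tm t"
  by (induction t) auto

lemma fv_map_fm: "fv_fm (map_fm f \<phi>) = fv_fm \<phi>"
  by (induction \<phi>) (auto simp: fv_map_tm)

lemma map_fm_formulas:
  "\<phi> \<in> formulas L X A \<Longrightarrow> f ` A \<subseteq> B \<Longrightarrow> map_fm f \<phi> \<in> formulas L X B"
  by (auto simp: formulas_def wf_map_fm fv_map_fm fm.set_map)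

lemma formulas_simps [simp]:
  "Falsum \<in> formulas L X A"
  "Neg \<phi> \<in> formulas L X A \<longleftrightarrow> \<phi> \<in> formulas L X A"
  "Conj \<phi> \<psi> \<in> formulas L X A \<longleftrightarrow> \<phi> \<in> formulas L X A \<and> \<psi> \<in> formulas L X A"
  by (auto simp: formulas_def)

section \<open>Type spaces\<close>

lemma tuples_nonempty: "universe M \<noteq> {} \<Longrightarrow> tuples M X \<noteq> {}"
  by (simp add: tuples_def PiE_eq_empty_iff)

definition fin_sat :: "('f, 'r, 'a) fo_struct \<Rightarrow> nat set \<Rightarrow> ('f, 'r, 'a) fm set \<Rightarrow> bool" where
  "fin_sat M X \<Gamma> \<longleftrightarrow> (\<forall>q. finite q \<and> q \<subseteq> \<Gamma> \<longrightarrow> (\<exists>a\<in>tuples M X. \<forall>\<phi>\<in>q. satisfies M a \<phi>))"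

lemma types_alt: "p \<in> types L M X \<longleftrightarrow> p \<subseteq> formulas_over L M X \<and> fin_sat M X p \<and>
    (\<forall>\<phi>\<in>formulas_over L M X. \<phi> \<in> p \<or> Neg \<phi> \<in> p)"
  by (simp add: types_def fin_sat_def)

lemma tp_types: "a \<in> tuples M X \<Longrightarrow> tp L M X a \<in> types L M X"
  by (auto simp: types_def tp_def)

lemma types_sat:
  "p \<in> types L M X \<Longrightarrow> finite q \<Longrightarrow> q \<subseteq> p \<Longrightarrow> \<exists>a\<in>tuples M X. \<forall>\<phi>\<in>q. satisfies M a \<phi>"
  by (simp add: types_def)

text \<open>
  The negation of a consequence of \<open>q\<close> cannot lie in the type, since together with \<open>q\<close> it has no
  solution in \<open>M\<close>; completeness then puts the consequence itself there.
\<close>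

lemma types_consequence:
  assumes p: "p \<in> types L M X" and q: "finite q" "q \<subseteq> p" and \<psi>: "\<psi> \<in> formulas_over L M X"
    and imp: "\<And>a. a \<in> tuples M X \<Longrightarrow> \<forall>\<phi>\<in>q. satisfies M a \<phi> \<Longrightarrow> satisfies M a \<psi>"
  shows "\<psi> \<in> p"
proof (rule ccontr)
  assume "\<psi> \<notin> p"
  then have "insert (Neg \<psi>) q \<subseteq> p" using p q \<psi> by (auto simp: types_alt)
  with types_sat[OF p, of "insert (Neg \<psi>) q"] q(1) imp show False by auto
qed

lemma types_Neg:
  assumes "p \<in> types L M X" "\<phi> \<in> formulas_over L M X"
  shows "Neg \<phi> \<in> p \<longleftrightarrow> \<phi> \<notin> p"
  using types_sat[OF assms(1), of "{\<phi>, Neg \<phi>}"] assms by (auto simp: types_alt)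

lemma types_Conj:
  assumes "p \<in> types L M X" "\<phi> \<in> formulas_over L M X" "\<psi> \<in> formulas_over L M X"
  shows "Conj \<phi> \<psi> \<in> p \<longleftrightarrow> \<phi> \<in> p \<and> \<psi> \<in> p"
proof
  assume "Conj \<phi> \<psi> \<in> p"
  then have q: "{Conj \<phi> \<psi>} \<subseteq> p" by simp
  show "\<phi> \<in> p \<and> \<psi> \<in> p"
    by (intro conjI; rule types_consequence[OF assms(1) _ q]) (simp_all add: assms)
next
  assume "\<phi> \<in> p \<and> \<psi> \<in> p"
  then have q: "{\<phi>, \<psi>} \<subseteq> p" by simp
  show "Conj \<phi> \<psi> \<in> p"
    by (rule types_consequence[OF assms(1) _ q]) (simp_all add: assms)
qed

lemma type_cyl_Neg:
  "\<phi> \<in> formulas_over L M X \<Longrightarrow> type_cyl L M X (Neg \<phi>) = types L M X - type_cyl L M X \<phi>"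
  by (auto simp: type_cyl_def types_Neg)

lemma type_cyl_Conj:
  "\<phi> \<in> formulas_over L M X \<Longrightarrow> \<psi> \<in> formulas_over L M X \<Longrightarrow>
    type_cyl L M X (Conj \<phi> \<psi>) = type_cyl L M X \<phi> \<inter> type_cyl L M X \<psi>"
  by (auto simp: type_cyl_def types_Conj)

lemma type_cyl_Falsum: "type_cyl L M X Falsum = {}"
proof -
  have "Falsum \<notin> p" if "p \<in> types L M X" for p
    using types_sat[OF that, of "{Falsum}"] by auto
  then show ?thesis by (auto simp: type_cyl_def)
qed

lemma type_cyl_Verum: "type_cyl L M X Verum = types L M X"
  by (simp add: type_cyl_Neg type_cyl_Falsum)

lemma type_cyl_Disj:
  assumes "\<phi> \<in> formulas_over L M X" "\<psi> \<in> formulas_over L M X"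
  shows "type_cyl L M X (Disj \<phi> \<psi>) = type_cyl L M X \<phi> \<union> type_cyl L M X \<psi>"
proof -
  have "type_cyl L M X \<phi> \<subseteq> types L M X" "type_cyl L M X \<psi> \<subseteq> types L M X"
    by (auto simp: type_cyl_def)
  then show ?thesis using assms by (auto simp: type_cyl_Neg type_cyl_Conj)
qed

lemma tp_type_cyl:
  "a \<in> tuples M X \<Longrightarrow> \<phi> \<in> formulas_over L M X \<Longrightarrow> tp L M X a \<in> type_cyl L M X \<phi> \<longleftrightarrow> satisfies M a \<phi>"
  by (auto simp: type_cyl_def tp_types) (auto simp: tp_def)

text \<open>
  Inclusions of cylinders can be tested at realized types, because a type is finitely satisfiable
  in \<open>M\<close> itself. Hence a Keisler measure is the same as a finitely additive measure on cylinders.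
\<close>

lemma type_cyl_subset_iff:
  assumes "\<phi> \<in> formulas_over L M X" "\<psi> \<in> formulas_over L M X"
  shows "type_cyl L M X \<phi> \<subseteq> type_cyl L M X \<psi> \<longleftrightarrow>
    (\<forall>a\<in>tuples M X. satisfies M a \<phi> \<longrightarrow> satisfies M a \<psi>)"
proof
  assume "type_cyl L M X \<phi> \<subseteq> type_cyl L M X \<psi>"
  then show "\<forall>a\<in>tuples M X. satisfies M a \<phi> \<longrightarrow> satisfies M a \<psi>"
    using tp_type_cyl[of _ M X _ L] assms by blast
next
  assume *: "\<forall>a\<in>tuples M X. satisfies M a \<phi> \<longrightarrow> satisfies M a \<psi>"
  then show "type_cyl L M X \<phi> \<subseteq> type_cyl L M X \<psi>"
    using types_consequence[of _ L M X "{\<phi>}" \<psi>, OF _ _ _ assms(2)] unfolding type_cyl_def by blast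
qed

abbreviation cylinders :: "('f, 'r) language \<Rightarrow> ('f, 'r, 'a) fo_struct \<Rightarrow> nat set
    \<Rightarrow> ('f, 'r, 'a) fm set set set" where
  "cylinders L M X \<equiv> type_cyl L M X ` formulas_over L M X"

lemma algebra_cylinders: "algebra (types L M X) (cylinders L M X)"
  unfolding algebra_iff_Int
proof (intro conjI ballI)
  show "cylinders L M X \<subseteq> Pow (types L M X)" by (auto simp: type_cyl_def)
  show "{} \<in> cylinders L M X" using type_cyl_Falsum[of L M X] by (intro image_eqI[of _ _ Falsum]) auto
  fix a assume "a \<in> cylinders L M X"
  then obtain \<phi> where \<phi>: "a = type_cyl L M X \<phi>" "\<phi> \<in> formulas_over L M X" by auto
  then show "types L M X - a \<in> cylinders L M X"
    by (intro image_eqI[of _ _ "Neg \<phi>"]) (auto simp: type_cyl_Neg)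
  fix b assume "b \<in> cylinders L M X"
  then obtain \<psi> where \<psi>: "b = type_cyl L M X \<psi>" "\<psi> \<in> formulas_over L M X" by auto
  then show "a \<inter> b \<in> cylinders L M X"
    using \<phi> by (intro image_eqI[of _ _ "Conj \<phi> \<psi>"]) (auto simp: type_cyl_Conj)
qed

lemma topspace_type_space: "topspace (type_space L M X) = types L M X"
  using algebra.top[OF algebra_cylinders, of L M X] algebra_iff_Int[of "types L M X" "cylinders L M X"] algebra_cylinders[of L M X]
  by (auto simp: type_space_def)

lemma openin_type_cyl: "\<phi> \<in> formulas_over L M X \<Longrightarrow> openin (type_space L M X) (type_cyl L M X \<phi>)"
  unfolding type_space_def by (rule topology_generated_by_Basis) auto

lemma type_space_base:
  assumes "openin (type_space L M X) U" "p \<in> U"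
  shows "\<exists>\<phi>\<in>formulas_over L M X. p \<in> type_cyl L M X \<phi> \<and> type_cyl L M X \<phi> \<subseteq> U"
proof -
  have "generate_topology_on (cylinders L M X) U"
    using assms(1) by (simp add: type_space_def openin_topology_generated_by_iff)
  then show ?thesis using assms(2)
  proof (induction arbitrary: p)
    case (Int a b)
    then obtain \<phi> \<psi> where "\<phi> \<in> formulas_over L M X" "p \<in> type_cyl L M X \<phi>" "type_cyl L M X \<phi> \<subseteq> a"
      "\<psi> \<in> formulas_over L M X" "p \<in> type_cyl L M X \<psi>" "type_cyl L M X \<psi> \<subseteq> b" by (metis IntE)
    then show ?case by (intro bexI[of _ "Conj \<phi> \<psi>"]) (auto simp: type_cyl_Conj)
  next
    case (UN K)
    then show ?case by (meson Union_iff Union_upper subset_trans)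
  qed auto
qed

text \<open>
  A maximal finitely satisfiable set is complete: if neither \<open>\<phi>\<close> nor its negation could be added,
  two finite subsets would refute \<open>\<phi>\<close> and \<open>\<not> \<phi>\<close>, and their union would have no solution.
\<close>

lemma extend_to_type:
  assumes \<Gamma>: "\<Gamma> \<subseteq> formulas_over L M X" "fin_sat M X \<Gamma>"
  shows "\<exists>p\<in>types L M X. \<Gamma> \<subseteq> p"
proof -
  define S where "S = {p. \<Gamma> \<subseteq> p \<and> p \<subseteq> formulas_over L M X \<and> fin_sat M X p}"
  have "\<exists>p\<in>S. \<forall>q\<in>S. p \<subseteq> q \<longrightarrow> q = p"
  proof (rule subset_Zorn_nonempty)
    show "S \<noteq> {}" using \<Gamma> by (auto simp: S_def)
    fix C assume C: "C \<noteq> {}" "subset.chain S C"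
    have "fin_sat M X (\<Union>C)" unfolding fin_sat_def
    proof (intro allI impI)
      fix q assume q: "finite q \<and> q \<subseteq> \<Union>C"
      then obtain c where "c \<in> C" "q \<subseteq> c"
        using finite_subset_Union_chain[of q C S] C by auto
      moreover have "fin_sat M X c" using C(2) \<open>c \<in> C\<close> by (auto simp: S_def subset.chain_def)
      ultimately show "\<exists>a\<in>tuples M X. \<forall>\<phi>\<in>q. satisfies M a \<phi>" using q by (auto simp: fin_sat_def)
    qed
    moreover have "\<Gamma> \<subseteq> \<Union>C" "\<Union>C \<subseteq> formulas_over L M X"
      using C by (fastforce simp: S_def subset.chain_def)+
    ultimately show "\<Union>C \<in> S" by (simp add: S_def)
  qed
  then obtain p where p: "p \<in> S" and max: "\<And>q. q \<in> S \<Longrightarrow> p \<subseteq> q \<Longrightarrow> q = p" by blast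
  have refuted: "\<exists>q. finite q \<and> q \<subseteq> p \<and> (\<forall>a\<in>tuples M X. (\<forall>\<psi>\<in>q. satisfies M a \<psi>) \<longrightarrow> \<not> satisfies M a \<phi>)"
    if \<phi>: "\<phi> \<in> formulas_over L M X" "\<phi> \<notin> p" for \<phi>
  proof -
    have "insert \<phi> p \<notin> S" using max[of "insert \<phi> p"] \<phi> by auto
    then have "\<not> fin_sat M X (insert \<phi> p)" using p \<phi> by (auto simp: S_def)
    then obtain q where q: "finite q" "q \<subseteq> insert \<phi> p" "\<And>a. a \<in> tuples M X \<Longrightarrow> \<not> (\<forall>\<psi>\<in>q. satisfies M a \<psi>)"
      by (auto simp: fin_sat_def)
    then show ?thesis by (intro exI[of _ "q - {\<phi>}"]) auto
  qed
  have "\<phi> \<in> p \<or> Neg \<phi> \<in> p" if \<phi>: "\<phi> \<in> formulas_over L M X" for \<phi>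
  proof (rule ccontr)
    assume "\<not> (\<phi> \<in> p \<or> Neg \<phi> \<in> p)"
    then obtain q1 q2 where q: "finite q1" "q1 \<subseteq> p" "finite q2" "q2 \<subseteq> p"
      "\<And>a. a\<in>tuples M X \<Longrightarrow> (\<forall>\<psi>\<in>q1. satisfies M a \<psi>) \<Longrightarrow> \<not> satisfies M a \<phi>"
      "\<And>a. a\<in>tuples M X \<Longrightarrow> (\<forall>\<psi>\<in>q2. satisfies M a \<psi>) \<Longrightarrow> \<not> satisfies M a (Neg \<phi>)"
      using refuted[of \<phi>] refuted[of "Neg \<phi>"] \<phi> unfolding formulas_simps by metis
    have "finite (q1 \<union> q2) \<and> q1 \<union> q2 \<subseteq> p" using q by auto
    moreover have "fin_sat M X p" using p by (simp add: S_def)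
    ultimately obtain a where "a \<in> tuples M X" "\<forall>\<psi>\<in>q1 \<union> q2. satisfies M a \<psi>"
      unfolding fin_sat_def by blast
    then show False using q(5)[of a] q(6)[of a] by auto
  qed
  then show ?thesis using p by (auto simp: S_def types_alt)
qed

text \<open>
  For a cover by cylinders without finite subcover, the negations of the cylinder formulas would be
  finitely satisfiable, and a type that contains all of them would not be covered.
\<close>

lemma compact_type_space: "compact_space (type_space L M X)"
  unfolding compact_space_alt
proof (intro allI impI)
  fix \<U> assume "(\<forall>U\<in>\<U>. openin (type_space L M X) U) \<and> topspace (type_space L M X) \<subseteq> \<Union>\<U>"
  then have op: "\<And>U. U \<in> \<U> \<Longrightarrow> openin (type_space L M X) U" and cov: "types L M X \<subseteq> \<Union>\<U>"
    by (auto simp: topspace_type_space)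
  define \<Phi> where "\<Phi> = {\<phi>\<in>formulas_over L M X. \<exists>U\<in>\<U>. type_cyl L M X \<phi> \<subseteq> U}"
  have "\<not> fin_sat M X (Neg ` \<Phi>)"
  proof
    assume "fin_sat M X (Neg ` \<Phi>)"
    moreover have "Neg ` \<Phi> \<subseteq> formulas_over L M X" by (auto simp: \<Phi>_def)
    ultimately obtain p where p: "p \<in> types L M X" "Neg ` \<Phi> \<subseteq> p"
      using extend_to_type by blast
    then obtain U where U: "U \<in> \<U>" "p \<in> U" using cov by auto
    obtain \<phi> where "\<phi>\<in>formulas_over L M X" "p \<in> type_cyl L M X \<phi>" "type_cyl L M X \<phi> \<subseteq> U"
      using type_space_base[OF op[OF U(1)] U(2)] by auto
    then have "\<phi> \<in> \<Phi>" "\<phi> \<in> p" "\<phi> \<in> formulas_over L M X" using U by (auto simp: \<Phi>_def type_cyl_def)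
    then show False using p types_Neg[OF p(1)] by auto
  qed
  then obtain q where q: "finite q" "q \<subseteq> Neg ` \<Phi>" "\<And>a. a \<in> tuples M X \<Longrightarrow> \<not> (\<forall>\<phi>\<in>q. satisfies M a \<phi>)"
    by (auto simp: fin_sat_def)
  then obtain \<Psi> where \<Psi>: "finite \<Psi>" "\<Psi> \<subseteq> \<Phi>" "q = Neg ` \<Psi>" by (meson finite_subset_image)
  have "\<forall>\<phi>\<in>\<Psi>. \<exists>U. U\<in>\<U> \<and> type_cyl L M X \<phi> \<subseteq> U" using \<Psi> by (auto simp: \<Phi>_def)
  then obtain V where V: "\<And>\<phi>. \<phi> \<in> \<Psi> \<Longrightarrow> V \<phi> \<in> \<U> \<and> type_cyl L M X \<phi> \<subseteq> V \<phi>" by metis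
  have "types L M X \<subseteq> \<Union>(V ` \<Psi>)"
  proof
    fix p assume p: "p \<in> types L M X"
    have "\<not> q \<subseteq> p" using types_sat[OF p q(1)] q(3) by blast
    then obtain \<phi> where "\<phi> \<in> \<Psi>" "Neg \<phi> \<notin> p" using \<Psi> by auto
    then have "p \<in> type_cyl L M X \<phi>" using p \<Psi>(2) types_Neg[OF p, of \<phi>] by (auto simp: type_cyl_def \<Phi>_def)
    then show "p \<in> \<Union>(V ` \<Psi>)" using V \<open>\<phi> \<in> \<Psi>\<close> by auto
  qed
  then show "\<exists>\<F>. finite \<F> \<and> \<F> \<subseteq> \<U> \<and> topspace (type_space L M X) \<subseteq> \<Union>\<F>"
    using \<Psi>(1) V by (intro exI[of _ "V ` \<Psi>"]) (auto simp: topspace_type_space)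
qed

lemma clopen_base_type_space: "clopen_base (type_space L M X) (cylinders L M X)"
proof (intro clopen_base.intro clopen_base_axioms.intro)
  show "algebra (topspace (type_space L M X)) (cylinders L M X)"
    unfolding topspace_type_space by (rule algebra_cylinders)
  show "compact_space (type_space L M X)" by (rule compact_type_space)
  show "openin (type_space L M X) a" if "a \<in> cylinders L M X" for a
    using that by (auto simp: openin_type_cyl)
  show "\<exists>a\<in>cylinders L M X. p \<in> a \<and> a \<subseteq> U" if "openin (type_space L M X) U" "p \<in> U" for U p
    using type_space_base[OF that] by auto
qed

section \<open>The Borel extension of a Keisler measure\<close>

lemma keisler_type_cyl_cong:
  assumes \<nu>: "\<nu> \<in> keisler_measures L M X"
    and "\<phi> \<in> formulas_over L M X" "\<psi> \<in> formulas_over L M X" "type_cyl L M X \<phi> = type_cyl L M X \<psi>"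
  shows "\<nu> \<phi> = \<nu> \<psi>"
proof -
  have "equiv_in M X \<phi> \<psi>"
    using type_cyl_subset_iff[of \<phi> L X M \<psi>] type_cyl_subset_iff[of \<psi> L X M \<phi>] assms(2-)
    by (auto simp: equiv_in_def)
  then show ?thesis using assms by (simp add: keisler_measures_def)
qed

lemma keisler_nonneg: "\<nu> \<in> keisler_measures L M X \<Longrightarrow> \<phi> \<in> formulas_over L M X \<Longrightarrow> 0 \<le> \<nu> \<phi>"
  by (simp add: keisler_measures_def)

lemma keisler_Verum: "\<nu> \<in> keisler_measures L M X \<Longrightarrow> \<nu> Verum = 1"
  by (simp add: keisler_measures_def)

lemma keisler_add:
  assumes "\<nu> \<in> keisler_measures L M X" "\<phi> \<in> formulas_over L M X" "\<psi> \<in> formulas_over L M X"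
    "type_cyl L M X \<phi> \<inter> type_cyl L M X \<psi> = {}"
  shows "\<nu> (Disj \<phi> \<psi>) = \<nu> \<phi> + \<nu> \<psi>"
proof -
  have "\<not> (satisfies M a \<phi> \<and> satisfies M a \<psi>)" if "a \<in> tuples M X" for a
    using tp_type_cyl[OF that, of \<phi> L] tp_type_cyl[OF that, of \<psi> L] assms by auto
  then have "equiv_in M X (Conj \<phi> \<psi>) Falsum" by (auto simp: equiv_in_def)
  then show ?thesis using assms by (simp add: keisler_measures_def)
qed

lemma keisler_le_1:
  assumes \<nu>: "\<nu> \<in> keisler_measures L M X" and \<phi>: "\<phi> \<in> formulas_over L M X"
  shows "\<nu> \<phi> \<le> 1"
proof -
  have "\<nu> \<phi> + \<nu> (Neg \<phi>) = \<nu> (Disj \<phi> (Neg \<phi>))"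
    using \<nu> \<phi> by (intro keisler_add[symmetric]) (auto simp: type_cyl_Neg)
  also have "\<dots> = \<nu> Verum"
  proof (rule keisler_type_cyl_cong[OF \<nu>])
    show "type_cyl L M X (Disj \<phi> (Neg \<phi>)) = type_cyl L M X Verum"
      using type_cyl_Disj[OF \<phi>, of "Neg \<phi>"] \<phi> unfolding type_cyl_Verum
      by (auto simp: type_cyl_Neg)
  qed (use \<phi> in auto)
  finally show ?thesis using keisler_nonneg[OF \<nu>, of "Neg \<phi>"] keisler_Verum[OF \<nu>] \<phi> by simp
qed

text \<open>
  The measure of a cylinder does not depend on the formula that defines it, so any choice of such
  a formula will do.
\<close>

definition cyl_measure :: "('f, 'r) language \<Rightarrow> ('f, 'r, 'a) fo_struct \<Rightarrow> nat set
    \<Rightarrow> (('f, 'r, 'a) fm \<Rightarrow> real) \<Rightarrow> ('f, 'r, 'a) fm set set \<Rightarrow> ennreal" where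
  "cyl_measure L M X \<nu> c = ennreal (\<nu> (SOME \<psi>. \<psi> \<in> formulas_over L M X \<and> type_cyl L M X \<psi> = c))"

lemma cyl_measure_type_cyl:
  assumes \<nu>: "\<nu> \<in> keisler_measures L M X" and \<phi>: "\<phi> \<in> formulas_over L M X"
  shows "cyl_measure L M X \<nu> (type_cyl L M X \<phi>) = ennreal (\<nu> \<phi>)"
proof -
  let ?P = "\<lambda>\<psi>. \<psi> \<in> formulas_over L M X \<and> type_cyl L M X \<psi> = type_cyl L M X \<phi>"
  have "?P (Eps ?P)" by (rule someI[of ?P \<phi>]) (simp add: \<phi>)
  then have "\<nu> (Eps ?P) = \<nu> \<phi>" using \<phi> by (intro keisler_type_cyl_cong[OF \<nu>]) auto
  then show ?thesis by (simp add: cyl_measure_def)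
qed

lemma clopen_premeasure_keisler:
  assumes \<nu>: "\<nu> \<in> keisler_measures L M X"
  shows "clopen_premeasure (type_space L M X) (cylinders L M X) (cyl_measure L M X \<nu>)"
proof (intro clopen_premeasure.intro clopen_premeasure_axioms.intro clopen_base_type_space)
  have "\<nu> (Disj Falsum Falsum) = \<nu> Falsum + \<nu> Falsum"
    by (intro keisler_add[OF \<nu>]) (auto simp: type_cyl_Falsum)
  moreover have "\<nu> (Disj Falsum Falsum) = \<nu> Falsum"
    by (intro keisler_type_cyl_cong[OF \<nu>]) (auto simp: type_cyl_Disj)
  ultimately show "positive (cylinders L M X) (cyl_measure L M X \<nu>)"
    using cyl_measure_type_cyl[OF \<nu>, of Falsum] by (simp add: positive_def type_cyl_Falsum)
  show "cyl_measure L M X \<nu> (topspace (type_space L M X)) = 1"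
    using cyl_measure_type_cyl[OF \<nu>, of Verum]
    by (simp add: type_cyl_Verum topspace_type_space keisler_Verum[OF \<nu>])
  show "additive (cylinders L M X) (cyl_measure L M X \<nu>)"
  proof (unfold additive_def, clarify)
    fix \<phi> \<psi> assume f: "\<phi> \<in> formulas_over L M X" "\<psi> \<in> formulas_over L M X"
      "type_cyl L M X \<phi> \<inter> type_cyl L M X \<psi> = {}"
    have "cyl_measure L M X \<nu> (type_cyl L M X \<phi> \<union> type_cyl L M X \<psi>) = ennreal (\<nu> (Disj \<phi> \<psi>))"
      using cyl_measure_type_cyl[OF \<nu>, of "Disj \<phi> \<psi>"] f by (simp add: type_cyl_Disj)
    also have "\<dots> = ennreal (\<nu> \<phi>) + ennreal (\<nu> \<psi>)"
      by (subst keisler_add[OF \<nu> f]) (simp add: f keisler_nonneg[OF \<nu>])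
    finally show "cyl_measure L M X \<nu> (type_cyl L M X \<phi> \<union> type_cyl L M X \<psi>)
      = cyl_measure L M X \<nu> (type_cyl L M X \<phi>) + cyl_measure L M X \<nu> (type_cyl L M X \<psi>)"
      by (simp add: cyl_measure_type_cyl[OF \<nu>] f)
  qed
qed

text \<open>
  Existence and uniqueness of the regular extension make the definite description in the
  definition of \<open>borel_extension\<close> denote.
\<close>

lemma
  assumes \<nu>: "\<nu> \<in> keisler_measures L M X"
  shows regular_borel_extension:
      "is_regular_borel_prob (type_space L M X) (borel_extension L M X \<nu>)" (is ?reg)
    and measure_borel_extension:
      "\<psi> \<in> formulas_over L M X \<Longrightarrow> measure (borel_extension L M X \<nu>) (type_cyl L M X \<psi>) = \<nu> \<psi>"
proof -
  interpret clopen_premeasure "type_space L M X" "cylinders L M X" "cyl_measure L M X \<nu>"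
    by (rule clopen_premeasure_keisler[OF \<nu>])
  let ?P = "\<lambda>N. is_regular_borel_prob (type_space L M X) N \<and>
     (\<forall>\<psi>\<in>formulas_over L M X. measure N (type_cyl L M X \<psi>) = \<nu> \<psi>)"
  have "?P borel_measure"
    using regular_borel_measure
    by (simp add: measure_def emeasure_borel_measure_base cyl_measure_type_cyl[OF \<nu>] keisler_nonneg[OF \<nu>])
  moreover have "N = borel_measure" if N: "?P N" for N
  proof (rule regular_extension_unique)
    show "is_regular_borel_prob (type_space L M X) N" using N by simp
    then interpret N: prob_space N by (simp add: is_regular_borel_prob_def)
    fix a assume "a \<in> cylinders L M X"
    then show "emeasure N a = cyl_measure L M X \<nu> a"
      using N by (auto simp: N.emeasure_eq_measure cyl_measure_type_cyl[OF \<nu>])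
  qed
  ultimately have "?P (borel_extension L M X \<nu>)"
    unfolding borel_extension_def by (rule theI[of ?P])
  then show ?reg and
    "\<psi> \<in> formulas_over L M X \<Longrightarrow> measure (borel_extension L M X \<nu>) (type_cyl L M X \<psi>) = \<nu> \<psi>"
    by auto
qed

section \<open>Fiber maps and step functions\<close>

lemma continuous_map_indicator_type_cyl:
  assumes \<phi>: "\<phi> \<in> formulas_over L M X"
  shows "continuous_map (type_space L M X) euclideanreal (indicator (type_cyl L M X \<phi>))"
  unfolding continuous_map_def topspace_type_space
proof (intro conjI allI impI)
  fix U :: "real set"
  let ?c = "type_cyl L M X \<phi>"
  have c: "?c \<subseteq> types L M X" by (auto simp: type_cyl_def)
  have "{p \<in> types L M X. indicator ?c p \<in> U} =
    (if 1 \<in> U then ?c else {}) \<union> (if 0 \<in> U then types L M X - ?c else {})" (is "?l = ?r")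
  proof (rule set_eqI)
    fix p show "p \<in> ?l \<longleftrightarrow> p \<in> ?r" using c by (cases "p \<in> ?c") auto
  qed
  moreover have "openin (type_space L M X) (types L M X - ?c)"
    using openin_type_cyl[of "Neg \<phi>" L X M] \<phi> by (simp add: type_cyl_Neg)
  moreover have "openin (type_space L M X) ?c" by (rule openin_type_cyl[OF \<phi>])
  ultimately show "openin (type_space L M X) {p \<in> types L M X. indicator ?c p \<in> U}"
    by (simp only: openin_Un openin_empty split: if_split) simp
qed auto

lemma is_fiber_map_continuous:
  assumes "is_fiber_map L M Y \<mu> \<phi> F"
  shows "continuous_map (type_space L M Y) euclideanreal F"
    and "p \<in> types L M Y \<Longrightarrow> 0 \<le> F p \<and> F p \<le> 1"
  using assms by (auto simp: is_fiber_map_def continuous_map_in_subtopology topspace_type_space)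

lemma tp_dense:
  assumes "openin (type_space L M X) U" "U \<noteq> {}"
  shows "\<exists>a\<in>tuples M X. tp L M X a \<in> U"
proof -
  obtain p where "p \<in> U" using assms by auto
  then obtain \<phi> where \<phi>: "\<phi> \<in> formulas_over L M X" "p \<in> type_cyl L M X \<phi>" "type_cyl L M X \<phi> \<subseteq> U"
    using type_space_base[OF assms(1)] by metis
  then obtain a where "a \<in> tuples M X" "satisfies M a \<phi>"
    using types_sat[of p L M X "{\<phi>}"] by (auto simp: type_cyl_def)
  then show ?thesis using tp_type_cyl[of a M X \<phi> L] \<phi> by auto
qed

text \<open>
  Realized types are dense. So a closed condition on a continuous function, such as a bound, may be
  checked in \<open>M\<close>; this gives the uniqueness of fiber maps and lets error estimates be stated
  without mentioning types.
\<close>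

lemma bound_by_density:
  assumes F: "continuous_map (type_space L M X) euclideanreal F"
    and bound: "\<And>a. a \<in> tuples M X \<Longrightarrow> \<bar>F (tp L M X a)\<bar> \<le> e" and p: "p \<in> types L M X"
  shows "\<bar>F p\<bar> \<le> e"
proof (rule ccontr)
  assume "\<not> \<bar>F p\<bar> \<le> e"
  let ?U = "{p \<in> topspace (type_space L M X). F p \<in> - {-e..e}}"
  have "openin (type_space L M X) ?U"
    by (rule openin_continuous_map_preimage[OF F]) (simp add: open_Compl)
  moreover have "p \<in> ?U" using p \<open>\<not> \<bar>F p\<bar> \<le> e\<close> by (auto simp: topspace_type_space)
  ultimately obtain a where "a \<in> tuples M X" "tp L M X a \<in> ?U" using tp_dense[of L M X ?U] by blast
  then show False using bound[of a] by auto
qed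

lemma fiber_map_eq:
  assumes F: "is_fiber_map L M Y \<mu> \<phi> F"
  shows "fiber_map L M Y \<mu> \<phi> = F"
  unfolding fiber_map_def
proof (rule the_equality)
  show "is_fiber_map L M Y \<mu> \<phi> F" by (rule F)
  fix G assume G: "is_fiber_map L M Y \<mu> \<phi> G"
  have "\<bar>G p - F p\<bar> \<le> 0" if "p \<in> types L M Y" for p
    by (rule bound_by_density[OF continuous_map_diff[OF is_fiber_map_continuous(1)[OF G] is_fiber_map_continuous(1)[OF F]] _ that])
      (use F G in \<open>auto simp: is_fiber_map_def\<close>)
  then show "G = F"
    using F G by (intro extensionalityI[of _ "types L M Y"]) (auto simp: is_fiber_map_def)
qed

lemma integral_borel_extension_approx:
  fixes w :: "'j \<Rightarrow> real"
  assumes \<nu>: "\<nu> \<in> keisler_measures L M Y"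
    and F: "continuous_map (type_space L M Y) euclideanreal F"
    and F01: "\<And>p. p \<in> types L M Y \<Longrightarrow> 0 \<le> F p \<and> F p \<le> 1"
    and \<theta>: "\<And>j. j \<in> J \<Longrightarrow> \<theta> j \<in> formulas_over L M Y"
    and approx: "\<And>p. p \<in> types L M Y \<Longrightarrow> \<bar>F p - (\<Sum>j\<in>J. w j * indicator (type_cyl L M Y (\<theta> j)) p)\<bar> \<le> e"
  shows "\<bar>(\<integral>p. F p \<partial>borel_extension L M Y \<nu>) - (\<Sum>j\<in>J. w j * \<nu> (\<theta> j))\<bar> \<le> e"
proof -
  let ?N = "borel_extension L M Y \<nu>" and ?T = "type_space L M Y"
  have reg: "is_regular_borel_prob ?T ?N" by (rule regular_borel_extension[OF \<nu>])
  then interpret prob_space ?N by (simp add: is_regular_borel_prob_def)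
  have sets: "sets ?N = sets (sigma (topspace ?T) {U. openin ?T U})"
    using reg by (simp add: is_regular_borel_prob_def)
  have opens: "{U. openin ?T U} \<subseteq> Pow (topspace ?T)" using openin_subset by auto
  have space: "space ?N = types L M Y"
    using sets_eq_imp_space_eq[OF sets] opens by (simp add: space_measure_of_conv topspace_type_space)
  have open_sets: "openin ?T U \<Longrightarrow> U \<in> sets ?N" for U using opens sets by auto
  have meas: "F \<in> borel_measurable ?N"
  proof (rule borel_measurableI)
    fix S :: "real set" assume "open S"
    then have "openin ?T {p \<in> topspace ?T. F p \<in> S}" by (intro openin_continuous_map_preimage[OF F]) simp
    moreover have "F -` S \<inter> space ?N = {p \<in> topspace ?T. F p \<in> S}" by (auto simp: space topspace_type_space)
    ultimately show "F -` S \<inter> space ?N \<in> sets ?N" using open_sets by simp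
  qed
  have cyl: "type_cyl L M Y (\<theta> j) \<in> sets ?N" if "j \<in> J" for j
    using \<theta>[OF that] by (intro open_sets openin_type_cyl)
  have intF: "integrable ?N F"
    using F01 meas by (intro integrable_const_bound[of _ 1]) (auto simp: space)
  let ?G = "\<lambda>p. \<Sum>j\<in>J. w j * indicator (type_cyl L M Y (\<theta> j)) p"
  have int_ind: "integrable ?N (\<lambda>p. w j * indicator (type_cyl L M Y (\<theta> j)) p)" if "j \<in> J" for j
    using cyl[OF that] by (intro integrable_mult_right integrable_real_indicator) (auto simp: emeasure_eq_measure)
  have intG: "integrable ?N ?G" by (rule Bochner_Integration.integrable_sum[OF int_ind])
  have "(\<integral>p. ?G p \<partial>?N) = (\<Sum>j\<in>J. \<integral>p. w j * indicator (type_cyl L M Y (\<theta> j)) p \<partial>?N)"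
    by (rule Bochner_Integration.integral_sum[OF int_ind])
  also have "\<dots> = (\<Sum>j\<in>J. w j * \<nu> (\<theta> j))"
  proof (rule sum.cong[OF refl])
    fix j assume j: "j \<in> J"
    show "(\<integral>p. w j * indicator (type_cyl L M Y (\<theta> j)) p \<partial>?N) = w j * \<nu> (\<theta> j)"
      using cyl[OF j] measure_borel_extension[OF \<nu> \<theta>[OF j]] sets.sets_into_space[OF cyl[OF j]]
      by (simp add: Int_absorb2)
  qed
  finally have G: "(\<integral>p. ?G p \<partial>?N) = (\<Sum>j\<in>J. w j * \<nu> (\<theta> j))" .
  have "(\<integral>p. F p \<partial>?N) - (\<Sum>j\<in>J. w j * \<nu> (\<theta> j)) = (\<integral>p. F p - ?G p \<partial>?N)"
    using intF intG G by simp
  also have "\<bar>\<dots>\<bar> \<le> (\<integral>p. \<bar>F p - ?G p\<bar> \<partial>?N)" by (rule integral_abs_bound)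
  also have "\<dots> \<le> (\<integral>p. e \<partial>?N)"
    using intF intG approx by (intro integral_mono) (auto simp: space)
  finally show ?thesis by (simp add: prob_space)
qed

text \<open>
  The heart of the comparison. If the values \<open>\<mu>(\<phi>(x,b))\<close> are within \<open>e\<close> of a step function of \<open>b\<close>
  given by formulas \<open>\<theta> j\<close>, then \<open>(\<mu> \<otimes> \<nu>)(\<phi>)\<close> is within \<open>e\<close> of the integral of that step function,
  a finite combination of values of \<open>\<nu>\<close>. The hypothesis speaks of points \<open>b\<close> and formulas only, and
  so can be moved between an ultraproduct and its factors. It applies to every \<open>\<mu>\<close> that has a fiber map
  at \<open>\<phi>\<close>, so in particular to the convex combinations of Dirac measures in the factors.
\<close>

lemma morley_product_approx:
  fixes w :: "'j \<Rightarrow> real"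
  assumes \<nu>: "\<nu> \<in> keisler_measures L M Y" and F: "is_fiber_map L M Y \<mu> \<phi> F"
    and \<phi>: "\<phi> \<in> formulas_over L M (X \<union> Y)"
    and \<theta>: "\<And>j. j \<in> J \<Longrightarrow> \<theta> j \<in> formulas_over L M Y" and J: "finite J"
    and approx: "\<And>b. b \<in> tuples M Y \<Longrightarrow>
      \<bar>\<mu> (inst_fm Y b \<phi>) - (\<Sum>j\<in>J. w j * of_bool (satisfies M b (\<theta> j)))\<bar> \<le> e"
  shows "\<bar>morley_product L M X Y \<mu> \<nu> \<phi> - (\<Sum>j\<in>J. w j * \<nu> (\<theta> j))\<bar> \<le> e"
proof -
  have "morley_product L M X Y \<mu> \<nu> \<phi> = (\<integral>p. F p \<partial>borel_extension L M Y \<nu>)"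
    using \<phi> by (simp add: morley_product_def fiber_map_eq[OF F])
  moreover have "\<bar>F p - (\<Sum>j\<in>J. w j * indicator (type_cyl L M Y (\<theta> j)) p)\<bar> \<le> e" if "p \<in> types L M Y" for p
  proof (rule bound_by_density[OF _ _ that])
    show "continuous_map (type_space L M Y) euclideanreal
      (\<lambda>p. F p - (\<Sum>j\<in>J. w j * indicator (type_cyl L M Y (\<theta> j)) p))"
      using \<theta> by (intro continuous_map_diff is_fiber_map_continuous(1)[OF F] continuous_map_sum[OF J]
        continuous_map_real_mult continuous_map_indicator_type_cyl) auto
    fix b assume b: "b \<in> tuples M Y"
    have "(\<Sum>j\<in>J. w j * indicator (type_cyl L M Y (\<theta> j)) (tp L M Y b))
      = (\<Sum>j\<in>J. w j * of_bool (satisfies M b (\<theta> j)))"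
      using \<theta> by (intro sum.cong) (auto simp: indicator_def tp_type_cyl[OF b])
    then show "\<bar>F (tp L M Y b) - (\<Sum>j\<in>J. w j * indicator (type_cyl L M Y (\<theta> j)) (tp L M Y b))\<bar> \<le> e"
      using approx[OF b] F b by (simp add: is_fiber_map_def)
  qed
  ultimately show ?thesis
    using integral_borel_extension_approx[OF \<nu> is_fiber_map_continuous[OF F] \<theta>, where w = w and J = J and e = e] by simp
qed

text \<open>
  For each level \<open>j/n\<close> separate the closed set \<open>{F \<ge> (j+1)/n}\<close> from the complement of the open set
  \<open>{F > j/n}\<close> by a cylinder. At a point with \<open>k \<le> n F < k+1\<close> the cylinders with \<open>j < k\<close> contain the
  point, those with \<open>j > k\<close> do not, so the number of cylinders around it is \<open>k\<close> or \<open>k+1\<close>. Averaging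
  over levels in this way avoids a partition of the type space.
\<close>

lemma step_approx:
  assumes F: "continuous_map (type_space L M Y) euclideanreal F"
    and F01: "\<And>p. p \<in> types L M Y \<Longrightarrow> 0 \<le> F p \<and> F p \<le> 1" and n: "0 < (n::nat)"
  shows "\<exists>\<theta>. (\<forall>j<n. \<theta> j \<in> formulas_over L M Y) \<and>
    (\<forall>p\<in>types L M Y. \<bar>F p - (\<Sum>j<n. 1 / n * indicator (type_cyl L M Y (\<theta> j)) p)\<bar> \<le> 1 / n)"
proof -
  interpret clopen_base "type_space L M Y" "cylinders L M Y" by (rule clopen_base_type_space)
  let ?T = "type_space L M Y"
  have "\<exists>\<theta>. \<theta> \<in> formulas_over L M Y \<and> {p \<in> types L M Y. F p \<ge> (real j + 1) / n} \<subseteq> type_cyl L M Y \<theta> \<and>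
    type_cyl L M Y \<theta> \<subseteq> {p \<in> types L M Y. F p > real j / n}" for j :: nat
  proof -
    have "closedin ?T {p \<in> topspace ?T. F p \<in> {(real j + 1) / n..}}"
      by (rule closedin_continuous_map_preimage[OF F]) simp
    then have K: "compactin ?T {p \<in> topspace ?T. F p \<in> {(real j + 1) / n..}}"
      by (rule closedin_compact_space[OF compact])
    have U: "openin ?T {p \<in> topspace ?T. F p \<in> {real j / n<..}}"
      by (rule openin_continuous_map_preimage[OF F]) simp
    have "real j / n < (real j + 1) / n" using n by (simp add: divide_strict_right_mono)
    then have "{p \<in> topspace ?T. F p \<in> {(real j + 1) / n..}} \<subseteq> {p \<in> topspace ?T. F p \<in> {real j / n<..}}"
      by auto
    then obtain a where "a \<in> cylinders L M Y" "{p \<in> topspace ?T. F p \<in> {(real j + 1) / n..}} \<subseteq> a"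
      "a \<subseteq> {p \<in> topspace ?T. F p \<in> {real j / n<..}}"
      by (rule clopen_separation[OF K U])
    then show ?thesis by (auto simp: topspace_type_space)
  qed
  from choice[OF allI[OF this]] obtain \<theta> where \<theta>: "\<And>j. \<theta> j \<in> formulas_over L M Y"
    "\<And>j. {p \<in> types L M Y. F p \<ge> (real j + 1) / n} \<subseteq> type_cyl L M Y (\<theta> j)"
    "\<And>j. type_cyl L M Y (\<theta> j) \<subseteq> {p \<in> types L M Y. F p > real j / n}" by fast
  show ?thesis
  proof (intro exI[of _ \<theta>] conjI allI impI ballI)
    show "\<theta> j \<in> formulas_over L M Y" for j by (rule \<theta>(1))
    fix p assume p: "p \<in> types L M Y"
    define S where "S = {j. j < n \<and> p \<in> type_cyl L M Y (\<theta> j)}"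
    define k where "k = nat \<lfloor>n * F p\<rfloor>"
    have k: "real k \<le> n * F p" "n * F p < real k + 1" using F01[OF p] by (auto simp: k_def)
    have "real k \<le> n" using k(1) F01[OF p] mult_left_le[of "F p" "real n"] by linarith
    then have kn: "k \<le> n" by simp
    have "{..<k} \<subseteq> S"
    proof
      fix j assume "j \<in> {..<k}"
      then have "real j + 1 \<le> real k" by simp
      then have "(real j + 1) / n \<le> F p" using k(1) n by (simp add: pos_divide_le_eq mult.commute)
      then show "j \<in> S" using \<theta>(2)[of j] p \<open>j \<in> {..<k}\<close> kn by (auto simp: S_def)
    qed
    moreover have "S \<subseteq> {..k}"
    proof
      fix j assume "j \<in> S"
      then have "real j / n < F p" using \<theta>(3)[of j] by (auto simp: S_def)
      then have "real j < n * F p" using n by (simp add: pos_divide_less_eq mult.commute)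
      then show "j \<in> {..k}" using k(2) by simp
    qed
    ultimately have "k \<le> card S" "card S \<le> k + 1"
      using card_mono[of S "{..<k}"] card_mono[of "{..k}" S] by (auto simp: S_def)
    then have "\<bar>n * F p - card S\<bar> \<le> 1" using k by linarith
    moreover have "(\<Sum>j<n. 1 / n * indicator (type_cyl L M Y (\<theta> j)) p) = card S / n"
    proof -
      have "(\<Sum>j<n. indicator (type_cyl L M Y (\<theta> j)) p) = (\<Sum>j\<in>S. 1 :: real)"
        by (rule sum.mono_neutral_cong_right) (auto simp: S_def)
      then show ?thesis unfolding sum_distrib_left[symmetric] by simp
    qed
    moreover have "F p - card S / n = (n * F p - card S) / n" using n by (simp add: field_simps)
    ultimately show "\<bar>F p - (\<Sum>j<n. 1 / n * indicator (type_cyl L M Y (\<theta> j)) p)\<bar> \<le> 1 / n"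
      using n by (simp add: abs_divide divide_right_mono)
  qed
qed

section \<open>Convex combinations of Dirac measures\<close>

lemma conv_measuresE:
  assumes "\<mu> \<in> conv_measures L M X"
  obtains n r a where "\<And>k. k \<in> {1..n::nat} \<Longrightarrow> a k \<in> tuples M X" "\<And>k. k \<in> {1..n} \<Longrightarrow> 0 < r k"
    "(\<Sum>k=1..n. r k) = (1::real)"
    "\<And>\<phi>. \<phi> \<in> formulas_over L M X \<Longrightarrow> \<mu> \<phi> = (\<Sum>k=1..n. r k * of_bool (satisfies M (a k) \<phi>))"
    "\<mu> \<in> extensional (formulas_over L M X)"
proof -
  from assms obtain n r a where *: "\<forall>k\<in>{1..n::nat}. a k \<in> tuples M X \<and> 0 < r k" "(\<Sum>k=1..n. r k) = (1::real)"
    and \<mu>: "\<mu> = (\<lambda>\<phi>\<in>formulas_over L M X. \<Sum>k=1..n. r k * dirac L M X (tp L M X (a k)) \<phi>)"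
    unfolding conv_measures_def by blast
  show ?thesis
  proof (rule that[of n a r])
    fix \<phi> assume \<phi>: "\<phi> \<in> formulas_over L M X"
    then show "\<mu> \<phi> = (\<Sum>k=1..n. r k * of_bool (satisfies M (a k) \<phi>))"
      by (simp add: \<mu> dirac_def tp_def of_bool_def)
  qed (use * in \<open>auto simp: \<mu>\<close>)
qed

lemma conv_measures_keisler:
  assumes "\<mu> \<in> conv_measures L M X"
  shows "\<mu> \<in> keisler_measures L M X"
proof -
  obtain n r a where a: "\<And>k. k \<in> {1..n::nat} \<Longrightarrow> a k \<in> tuples M X"
    and r: "\<And>k. k \<in> {1..n} \<Longrightarrow> 0 < r k" "(\<Sum>k=1..n. r k) = (1::real)"
    and \<mu>: "\<And>\<phi>. \<phi> \<in> formulas_over L M X \<Longrightarrow> \<mu> \<phi> = (\<Sum>k=1..n. r k * of_bool (satisfies M (a k) \<phi>))"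
    and ext: "\<mu> \<in> extensional (formulas_over L M X)" by (rule conv_measuresE[OF assms]) blast
  show ?thesis unfolding keisler_measures_def
  proof (intro CollectI conjI ballI impI ext)
    fix \<phi> \<psi> assume f: "\<phi> \<in> formulas_over L M X" "\<psi> \<in> formulas_over L M X"
    show "\<mu> \<phi> = \<mu> \<psi>" if "equiv_in M X \<phi> \<psi>"
      unfolding \<mu>[OF f(1)] \<mu>[OF f(2)] using that a by (intro sum.cong) (auto simp: equiv_in_def)
    show "\<mu> (Disj \<phi> \<psi>) = \<mu> \<phi> + \<mu> \<psi>" if "equiv_in M X (Conj \<phi> \<psi>) Falsum"
    proof -
      have d: "Disj \<phi> \<psi> \<in> formulas_over L M X" using f by simp
      have "r k * of_bool (satisfies M (a k) (Disj \<phi> \<psi>))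
        = r k * of_bool (satisfies M (a k) \<phi>) + r k * of_bool (satisfies M (a k) \<psi>)" if "k \<in> {1..n}" for k
        using a[OF that] \<open>equiv_in M X (Conj \<phi> \<psi>) Falsum\<close> by (auto simp: equiv_in_def)
      then show ?thesis unfolding \<mu>[OF d] \<mu>[OF f(1)] \<mu>[OF f(2)] sum.distrib[symmetric]
        by (rule sum.cong[OF refl])
    qed
  next
    fix \<phi> assume f: "\<phi> \<in> formulas_over L M X"
    show "0 \<le> \<mu> \<phi>" unfolding \<mu>[OF f] using r(1) by (intro sum_nonneg mult_nonneg_nonneg) (auto intro: less_imp_le)
  next
    show "\<mu> Verum = 1" using r(2) by (simp add: \<mu>)
  qed
qed

text \<open>
  For \<open>\<mu> = \<Sum> r k \<delta>(a k)\<close> the fiber function is itself a step function,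
  the combination of the indicators of the cylinders of \<open>\<phi>(a k, y)\<close>.
\<close>

lemma conv_measures_fiber_map:
  assumes \<mu>: "\<mu> \<in> conv_measures L M X" and XY: "X \<inter> Y = {}" and \<phi>: "\<phi> \<in> formulas_over L M (X \<union> Y)"
  shows "\<exists>F. is_fiber_map L M Y \<mu> \<phi> F"
proof -
  obtain n r a where a: "\<And>k. k \<in> {1..n::nat} \<Longrightarrow> a k \<in> tuples M X"
    and r: "\<And>k. k \<in> {1..n} \<Longrightarrow> 0 < r k" "(\<Sum>k=1..n. r k) = (1::real)"
    and \<mu>: "\<And>\<phi>. \<phi> \<in> formulas_over L M X \<Longrightarrow> \<mu> \<phi> = (\<Sum>k=1..n. r k * of_bool (satisfies M (a k) \<phi>))"
    by (rule conv_measuresE[OF \<mu>]) blast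
  let ?\<psi> = "\<lambda>k. inst_fm X (a k) \<phi>"
  let ?G = "\<lambda>p. \<Sum>k=1..n. r k * indicator (type_cyl L M Y (?\<psi> k)) p"
  have \<psi>: "?\<psi> k \<in> formulas_over L M Y" if "k \<in> {1..n}" for k
    using inst_fm_formulas_over[of \<phi> L Y X M "a k"] \<phi> a[OF that] by (simp add: Un_commute)
  have "continuous_map (type_space L M Y) euclideanreal ?G"
    using \<psi> by (intro continuous_map_sum continuous_map_real_mult continuous_map_indicator_type_cyl) auto
  then have cont: "continuous_map (type_space L M Y) euclideanreal (restrict ?G (types L M Y))"
    by (rule continuous_map_eq) (simp add: topspace_type_space)
  have "0 \<le> ?G p \<and> ?G p \<le> 1" for p
  proof
    show "0 \<le> ?G p" using r(1) by (intro sum_nonneg mult_nonneg_nonneg) (auto intro: less_imp_le)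
    have "?G p \<le> (\<Sum>k=1..n. r k)" using r(1) by (intro sum_mono) (auto simp: indicator_def less_imp_le)
    then show "?G p \<le> 1" using r(2) by simp
  qed
  then have range: "restrict ?G (types L M Y) \<in> topspace (type_space L M Y) \<rightarrow> {0..1}"
    by (auto simp: topspace_type_space)
  have "?G (tp L M Y b) = \<mu> (inst_fm Y b \<phi>)" if b: "b \<in> tuples M Y" for b
    unfolding \<mu>[OF inst_fm_formulas_over[OF \<phi> b]]
  proof (rule sum.cong[OF refl])
    fix k assume k: "k \<in> {1..n}"
    have "satisfies M b (?\<psi> k) \<longleftrightarrow> satisfies M (a k) (inst_fm Y b \<phi>)"
      unfolding satisfies_inst_fm using \<phi> XY by (intro satisfies_cong) (auto simp: formulas_def)
    then show "r k * indicator (type_cyl L M Y (?\<psi> k)) (tp L M Y b) = r k * of_bool (satisfies M (a k) (inst_fm Y b \<phi>))"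
      using tp_type_cyl[OF b \<psi>[OF k]] by (simp add: indicator_def)
  qed
  then have "is_fiber_map L M Y \<mu> \<phi> (restrict ?G (types L M Y))"
    using cont range unfolding is_fiber_map_def continuous_map_in_subtopology
    by (auto simp: tp_types)
  then show ?thesis by blast
qed

section \<open>Definability for formulas with parameters\<close>

text \<open>
  Definability concerns formulas without parameters, while the Morley product is evaluated at
  formulas \<open>\<phi>(x,y,c)\<close>. The parameters are turned into fresh variables \<open>z\<close>, and the fiber map of
  \<open>\<phi>(x,yz)\<close> is pulled back along the continuous map \<open>tp(b) \<mapsto> tp(bc)\<close> from types in \<open>y\<close> to types
  in \<open>yz\<close>. The function \<open>h\<close> assigns the variables to the parameters.
\<close>

primrec unpar_tm :: "('p \<Rightarrow> nat) \<Rightarrow> ('f, 'p) tm \<Rightarrow> ('f, 'p) tm" where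
  "unpar_tm h (Var v) = Var v"
| "unpar_tm h (Par a) = Var (h a)"
| "unpar_tm h (Fn f ts) = Fn f (map (unpar_tm h) ts)"

primrec unpar_fm :: "('p \<Rightarrow> nat) \<Rightarrow> ('f, 'r, 'p) fm \<Rightarrow> ('f, 'r, 'p) fm" where
  "unpar_fm h Falsum = Falsum"
| "unpar_fm h (Equal s t) = Equal (unpar_tm h s) (unpar_tm h t)"
| "unpar_fm h (Rel R ts) = Rel R (map (unpar_tm h) ts)"
| "unpar_fm h (Neg \<phi>) = Neg (unpar_fm h \<phi>)"
| "unpar_fm h (Conj \<phi> \<psi>) = Conj (unpar_fm h \<phi>) (unpar_fm h \<psi>)"
| "unpar_fm h (Exists v \<phi>) = Exists v (unpar_fm h \<phi>)"

text \<open>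
  The bound variables are included: a new variable must not be caught by a quantifier.
\<close>

primrec vars_fm :: "('f, 'r, 'p) fm \<Rightarrow> nat set" where
  "vars_fm Falsum = {}"
| "vars_fm (Equal s t) = fv_tm s \<union> fv_tm t"
| "vars_fm (Rel R ts) = \<Union>(set (map fv_tm ts))"
| "vars_fm (Neg \<phi>) = vars_fm \<phi>"
| "vars_fm (Conj \<phi> \<psi>) = vars_fm \<phi> \<union> vars_fm \<psi>"
| "vars_fm (Exists v \<phi>) = insert v (vars_fm \<phi>)"

lemma finite_fv_tm: "finite (fv_tm t)"
  by (induction t) auto

lemma finite_vars_fm: "finite (vars_fm \<phi>)"
  by (induction \<phi>) (auto simp: finite_fv_tm)

lemma finite_pars_tm: "finite (pars_tm t)"
  by (induction t) auto

lemma finite_pars_fm: "finite (pars_fm \<phi>)"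
  by (induction \<phi>) (auto simp: finite_pars_tm)

lemma wf_unpar_tm: "wf_tm L (unpar_tm h t) \<longleftrightarrow> wf_tm L t"
  by (induction t) (auto simp: list_all_iff)

lemma wf_unpar_fm: "wf_fm L (unpar_fm h \<phi>) \<longleftrightarrow> wf_fm L \<phi>"
  by (induction \<phi>) (auto simp: wf_unpar_tm list_all_iff)

lemma fv_unpar_tm: "fv_tm (unpar_tm h t) = fv_tm t \<union> h ` pars_tm t"
  by (induction t) auto

lemma fv_unpar_fm: "fv_fm (unpar_fm h \<phi>) \<subseteq> fv_fm \<phi> \<union> h ` pars_fm \<phi>"
  by (induction \<phi>) (auto simp: fv_unpar_tm)

lemma pars_unpar_tm: "pars_tm (unpar_tm h t) = {}"
  by (induction t) auto

lemma pars_unpar_fm: "pars_fm (unpar_fm h \<phi>) = {}"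
  by (induction \<phi>) (auto simp: pars_unpar_tm)

lemma inst_unpar_tm:
  assumes "fv_tm t \<inter> Z = {}" "\<And>a. a \<in> pars_tm t \<Longrightarrow> h a \<in> Z \<and> g (h a) = a"
  shows "inst_tm (W \<union> Z) g (unpar_tm h t) = inst_tm W g t"
  using assms
proof (induction t)
  case (Fn f ts)
  have "inst_tm (W \<union> Z) g (unpar_tm h t) = inst_tm W g t" if "t \<in> set ts" for t
    using that Fn.prems by (intro Fn.IH) auto
  then show ?case by simp
qed auto

lemma inst_unpar_fm:
  assumes "vars_fm \<phi> \<inter> Z = {}" "\<And>a. a \<in> pars_fm \<phi> \<Longrightarrow> h a \<in> Z \<and> g (h a) = a"
  shows "inst_fm (W \<union> Z) g (unpar_fm h \<phi>) = inst_fm W g \<phi>"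
  using assms
proof (induction \<phi> arbitrary: W)
  case (Rel R ts)
  then show ?case by (auto intro!: inst_unpar_tm)
next
  case (Exists v \<phi>)
  then have "(W \<union> Z) - {v} = (W - {v}) \<union> Z" by auto
  moreover have "inst_fm ((W - {v}) \<union> Z) g (unpar_fm h \<phi>) = inst_fm (W - {v}) g \<phi>"
    using Exists.prems by (intro Exists.IH) auto
  ultimately show ?case by simp
next
  case (Equal s t)
  then show ?case by (simp add: inst_unpar_tm disjoint_iff)
next
  case (Conj \<phi> \<psi>)
  have "inst_fm (W \<union> Z) g (unpar_fm h \<phi>) = inst_fm W g \<phi>" "inst_fm (W \<union> Z) g (unpar_fm h \<psi>) = inst_fm W g \<psi>"
    by (rule Conj.IH; use Conj.prems in auto)+
  then show ?case by simp
qed simp_all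

text \<open>
  If \<open>b\<close> realizes \<open>p\<close>, this is the type of \<open>bc\<close>.
\<close>

definition subst_type :: "('f, 'r) language \<Rightarrow> ('f, 'r, 'a) fo_struct \<Rightarrow> nat set \<Rightarrow> nat set \<Rightarrow> (nat \<Rightarrow> 'a)
    \<Rightarrow> ('f, 'r, 'a) fm set \<Rightarrow> ('f, 'r, 'a) fm set" where
  "subst_type L M Y Z c p = {\<psi> \<in> formulas_over L M (Y \<union> Z). inst_fm Z c \<psi> \<in> p}"

definition merge :: "nat set \<Rightarrow> (nat \<Rightarrow> 'a) \<Rightarrow> (nat \<Rightarrow> 'a) \<Rightarrow> nat \<Rightarrow> 'a" where
  "merge Z c b = (\<lambda>v. if v \<in> Z then c v else b v)"

lemma merge_tuples:
  "b \<in> tuples M Y \<Longrightarrow> c \<in> tuples M Z \<Longrightarrow> merge Z c b \<in> tuples M (Y \<union> Z)"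
  by (auto simp: tuples_def merge_def PiE_iff extensional_def)

lemma subst_type_types:
  assumes c: "c \<in> tuples M Z" and p: "p \<in> types L M Y"
  shows "subst_type L M Y Z c p \<in> types L M (Y \<union> Z)"
  unfolding types_def
proof (intro CollectI conjI allI impI ballI)
  show "subst_type L M Y Z c p \<subseteq> formulas_over L M (Y \<union> Z)" by (auto simp: subst_type_def)
  fix q assume q: "finite q \<and> q \<subseteq> subst_type L M Y Z c p"
  then have "finite (inst_fm Z c ` q)" "inst_fm Z c ` q \<subseteq> p" by (auto simp: subst_type_def)
  from types_sat[OF p this] obtain b where b: "b \<in> tuples M Y" "\<forall>\<psi>\<in>q. satisfies M b (inst_fm Z c \<psi>)" by auto
  then show "\<exists>a\<in>tuples M (Y \<union> Z). \<forall>\<phi>\<in>q. satisfies M a \<phi>"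
    using merge_tuples[OF b(1) c] by (intro bexI[of _ "merge Z c b"]) (auto simp: satisfies_inst_fm merge_def)
next
  fix \<psi> assume \<psi>: "\<psi> \<in> formulas_over L M (Y \<union> Z)"
  have "inst_fm Z c \<psi> \<in> formulas_over L M Y" by (rule inst_fm_formulas_over[OF \<psi> c])
  then show "\<psi> \<in> subst_type L M Y Z c p \<or> Neg \<psi> \<in> subst_type L M Y Z c p"
    using p \<psi> by (auto simp: types_def subst_type_def)
qed

lemma subst_type_tp:
  assumes b: "b \<in> tuples M Y" and c: "c \<in> tuples M Z"
  shows "subst_type L M Y Z c (tp L M Y b) = tp L M (Y \<union> Z) (merge Z c b)"
  using inst_fm_formulas_over[OF _ c, of _ L Y]
  by (auto simp: subst_type_def tp_def satisfies_inst_fm merge_def)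

lemma continuous_map_subst_type:
  assumes c: "c \<in> tuples M Z"
  shows "continuous_map (type_space L M Y) (type_space L M (Y \<union> Z)) (subst_type L M Y Z c)"
  unfolding type_space_def[of L M "Y \<union> Z"] continuous_on_generated_topo_iff
proof (intro conjI allI impI)
  show "subst_type L M Y Z c ` topspace (type_space L M Y) \<subseteq> \<Union> (cylinders L M (Y \<union> Z))"
    using subst_type_types[OF c, of _ L Y] topspace_type_space[of L M "Y \<union> Z"]
    by (auto simp: topspace_type_space type_space_def[of L M "Y \<union> Z"])
  fix U assume "U \<in> cylinders L M (Y \<union> Z)"
  then obtain \<psi> where \<psi>: "\<psi> \<in> formulas_over L M (Y \<union> Z)" "U = type_cyl L M (Y \<union> Z) \<psi>" by auto
  have "subst_type L M Y Z c -` U \<inter> topspace (type_space L M Y) = type_cyl L M Y (inst_fm Z c \<psi>)"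
    using subst_type_types[OF c, of _ L Y] \<psi>
    by (auto simp: topspace_type_space type_cyl_def) (auto simp: subst_type_def)
  then show "openin (type_space L M Y) (subst_type L M Y Z c -` U \<inter> topspace (type_space L M Y))"
    using openin_type_cyl[OF inst_fm_formulas_over[OF \<psi>(1) c]] by simp
qed

lemma definable_fiber_map:
  assumes def: "definable L M X \<mu>" and fin: "finite X" "finite Y" and XY: "X \<inter> Y = {}"
    and \<phi>: "\<phi> \<in> formulas_over L M (X \<union> Y)"
  shows "\<exists>F. is_fiber_map L M Y \<mu> \<phi> F"
proof -
  define V where "V = X \<union> Y \<union> vars_fm \<phi>"
  have "finite V" using fin by (simp add: V_def finite_vars_fm)
  then obtain Z0 where Z0: "Z0 \<subseteq> - V" "card Z0 = card (pars_fm \<phi>)" "finite Z0"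
    using infinite_arbitrarily_large[of "- V" "card (pars_fm \<phi>)"] by (auto simp: finite_compl)
  obtain h where h: "bij_betw h (pars_fm \<phi>) Z0"
    using finite_same_card_bij[OF finite_pars_fm Z0(3) Z0(2)[symmetric]] by blast
  define Z where "Z = Z0"
  define c where "c = restrict (inv_into (pars_fm \<phi>) h) Z"
  have hZ: "h a \<in> Z" "c (h a) = a" if "a \<in> pars_fm \<phi>" for a
    using h that bij_betw_inv_into_left[OF h that] by (auto simp: Z_def c_def bij_betw_def)
  have c: "c \<in> tuples M Z"
    using \<phi> bij_betw_inv_into[OF h] by (auto simp: tuples_def c_def Z_def formulas_def bij_betw_def)
  have Z: "finite Z" "Z \<inter> X = {}" "Z \<inter> Y = {}" "vars_fm \<phi> \<inter> Z = {}" using Z0 by (auto simp: Z_def V_def)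
  let ?\<psi> = "unpar_fm h \<phi>"
  have "?\<psi> \<in> formulas L (X \<union> (Y \<union> Z)) {}"
    using \<phi> fv_unpar_fm[of h \<phi>] hZ by (auto simp: formulas_def wf_unpar_fm pars_unpar_fm)
  moreover have "finite (Y \<union> Z)" "X \<inter> (Y \<union> Z) = {}" using fin Z XY by auto
  ultimately obtain G where G: "is_fiber_map L M (Y \<union> Z) \<mu> ?\<psi> G"
    using def unfolding definable_def by blast
  let ?F = "restrict (G \<circ> subst_type L M Y Z c) (types L M Y)"
  have "continuous_map (type_space L M Y) (top_of_set {0..1}) (G \<circ> subst_type L M Y Z c)"
    using G by (intro continuous_map_compose[OF continuous_map_subst_type[OF c]]) (simp add: is_fiber_map_def)
  then have "continuous_map (type_space L M Y) (top_of_set {0..1}) ?F"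
    by (rule continuous_map_eq) (simp add: topspace_type_space)
  moreover have "?F (tp L M Y b) = \<mu> (inst_fm Y b \<phi>)" if b: "b \<in> tuples M Y" for b
  proof -
    have "?F (tp L M Y b) = G (tp L M (Y \<union> Z) (merge Z c b))"
      by (simp add: tp_types[OF b] subst_type_tp[OF b c])
    also have "\<dots> = \<mu> (inst_fm (Y \<union> Z) (merge Z c b) ?\<psi>)"
      using G merge_tuples[OF b c] by (simp add: is_fiber_map_def)
    also have "inst_fm (Y \<union> Z) (merge Z c b) ?\<psi> = inst_fm Y (merge Z c b) \<phi>"
      using Z(4) hZ by (intro inst_unpar_fm) (auto simp: merge_def)
    also have "\<dots> = inst_fm Y b \<phi>" using Z(3) by (intro inst_fm_cong) (auto simp: merge_def)
    finally show ?thesis .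
  qed
  ultimately have "is_fiber_map L M Y \<mu> \<phi> ?F" by (simp add: is_fiber_map_def)
  then show ?thesis by blast
qed

section \<open>Ultraproducts and the theorem of Los\<close>

locale ultraproduct_family =
  fixes L :: "('f, 'r) language" and M :: "'i \<Rightarrow> ('f, 'r, 'a) fo_struct" and D :: "'i filter"
  assumes struct: "\<And>i. is_struct L (M i)"
    and ultra: "nonprincipal_ultrafilter D"
begin

abbreviation "U \<equiv> ultraproduct D M"

definition ultra_class :: "('i \<Rightarrow> 'a) \<Rightarrow> ('i \<Rightarrow> 'a) set" where
  "ultra_class g = ultra_rel D M `` {g}"

text \<open>
  For \<open>\<phi> = \<phi>(x, b)\<close> over the ultraproduct, \<open>localize i \<phi>\<close> is \<open>\<phi>(x, b(i))\<close> over \<open>M i\<close>.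
\<close>

definition localize :: "'i \<Rightarrow> ('f, 'r, ('i \<Rightarrow> 'a) set) fm \<Rightarrow> ('f, 'r, 'a) fm" where
  "localize i = map_fm (\<lambda>B. rep B i)"

lemma D_nontrivial: "D \<noteq> bot"
  using ultra by (simp add: nonprincipal_ultrafilter_def)

lemma eventually_not: "eventually (\<lambda>i. \<not> P i) D \<longleftrightarrow> \<not> eventually P D"
proof
  assume "eventually (\<lambda>i. \<not> P i) D"
  show "\<not> eventually P D"
  proof
    assume "eventually P D"
    with \<open>eventually (\<lambda>i. \<not> P i) D\<close> have "eventually (\<lambda>i. False) D" by eventually_elim simp
    then show False using D_nontrivial by (simp add: eventually_False)
  qed
qed (use ultra in \<open>auto simp: nonprincipal_ultrafilter_def\<close>)

lemma universe_nonempty: "universe (M i) \<noteq> {}"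
  using struct by (simp add: is_struct_def)

lemma equiv_ultra_rel: "equiv (\<Pi> i\<in>UNIV. universe (M i)) (ultra_rel D M)"
proof (rule equivI)
  show "sym (ultra_rel D M)" by (auto simp: sym_def ultra_rel_def elim: eventually_mono)
  show "trans (ultra_rel D M)"
  proof (rule transI)
    fix g h k assume "(g, h) \<in> ultra_rel D M" "(h, k) \<in> ultra_rel D M"
    then have "eventually (\<lambda>i. g i = h i) D" "eventually (\<lambda>i. h i = k i) D"
      by (auto simp: ultra_rel_def)
    then have "eventually (\<lambda>i. g i = k i) D" by eventually_elim simp
    with \<open>(g, h) \<in> ultra_rel D M\<close> \<open>(h, k) \<in> ultra_rel D M\<close> show "(g, k) \<in> ultra_rel D M"
      by (simp add: ultra_rel_def)
  qed
qed (auto simp: ultra_rel_def refl_on_def)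

lemma universe_ultraproduct: "universe U = (\<Pi> i\<in>UNIV. universe (M i)) // ultra_rel D M"
  by (simp add: ultraproduct_def)

lemma ultra_class_universe: "(\<And>i. g i \<in> universe (M i)) \<Longrightarrow> ultra_class g \<in> universe U"
  unfolding universe_ultraproduct ultra_class_def by (intro quotientI) auto

lemma universe_ultraproductE:
  assumes "B \<in> universe U"
  obtains g where "\<And>i. g i \<in> universe (M i)" "B = ultra_class g"
  using assms unfolding universe_ultraproduct ultra_class_def by (auto elim!: quotientE)

lemma rep_ultra_class:
  assumes "\<And>i. g i \<in> universe (M i)"
  shows "rep (ultra_class g) i \<in> universe (M i)" "eventually (\<lambda>i. rep (ultra_class g) i = g i) D"
proof -
  have "g \<in> ultra_class g" using assms by (auto simp: ultra_class_def ultra_rel_def)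
  then have "rep (ultra_class g) \<in> ultra_class g" unfolding rep_def by (rule someI[where P = "\<lambda>h. h \<in> ultra_class g"])
  then have "(g, rep (ultra_class g)) \<in> ultra_rel D M" by (simp add: ultra_class_def)
  then show "rep (ultra_class g) i \<in> universe (M i)" "eventually (\<lambda>i. rep (ultra_class g) i = g i) D"
    by (auto simp: ultra_rel_def elim: eventually_mono)
qed

lemma rep_universe: "B \<in> universe U \<Longrightarrow> rep B i \<in> universe (M i)"
  by (erule universe_ultraproductE) (simp add: rep_ultra_class)

lemma ultra_class_rep: "B \<in> universe U \<Longrightarrow> ultra_class (rep B) = B"
proof (erule universe_ultraproductE)
  fix g assume g: "\<And>i. g i \<in> universe (M i)" "B = ultra_class g"
  have "(rep B, g) \<in> ultra_rel D M"
    using g rep_ultra_class[OF g(1)] by (auto simp: ultra_rel_def)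
  then show "ultra_class (rep B) = B"
    using equiv_class_eq[OF equiv_ultra_rel] g by (simp add: ultra_class_def)
qed

lemma universe_ultraproduct_eq_iff:
  assumes "B \<in> universe U" "C \<in> universe U"
  shows "B = C \<longleftrightarrow> eventually (\<lambda>i. rep B i = rep C i) D"
proof
  assume "eventually (\<lambda>i. rep B i = rep C i) D"
  then have "(rep B, rep C) \<in> ultra_rel D M"
    using rep_universe assms by (auto simp: ultra_rel_def)
  then have "ultra_class (rep B) = ultra_class (rep C)"
    using equiv_class_eq[OF equiv_ultra_rel] by (simp add: ultra_class_def)
  then show "B = C" by (simp add: ultra_class_rep assms)
qed simp

lemma eval_tm_ultraproduct:
  assumes "wf_tm L t" "pars_tm t \<subseteq> universe U" "\<And>v. v \<in> fv_tm t \<Longrightarrow> e v \<in> universe U"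
  shows "eval_tm U e t \<in> universe U \<and>
    eventually (\<lambda>i. eval_tm (M i) (\<lambda>v. rep (e v) i) (map_tm (\<lambda>B. rep B i) t) = rep (eval_tm U e t) i) D"
  using assms
proof (induction t)
  case (Fn f ts)
  have IH: "eval_tm U e t \<in> universe U"
    "eventually (\<lambda>i. eval_tm (M i) (\<lambda>v. rep (e v) i) (map_tm (\<lambda>B. rep B i) t) = rep (eval_tm U e t) i) D"
    if "t \<in> set ts" for t
    using Fn.IH[OF that] Fn.prems that by (auto simp: list_all_iff)
  let ?args = "\<lambda>i. map (\<lambda>B. rep B i) (map (eval_tm U e) ts)"
  let ?g = "\<lambda>i. fun_interp (M i) f (?args i)"
  have g: "?g i \<in> universe (M i)" for i
  proof -
    have "set (?args i) \<subseteq> universe (M i)" using rep_universe IH(1) by auto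
    moreover have "length (?args i) = fun_arity L f" "f \<in> Funs L" using Fn.prems(1) by auto
    ultimately show ?thesis using struct[of i] unfolding is_struct_def by blast
  qed
  have val: "eval_tm U e (Fn f ts) = ultra_class ?g" by (simp add: ultraproduct_def ultra_class_def)
  have "eventually (\<lambda>i. \<forall>t\<in>set ts. eval_tm (M i) (\<lambda>v. rep (e v) i) (map_tm (\<lambda>B. rep B i) t)
      = rep (eval_tm U e t) i) D"
    using IH(2) by (intro eventually_ball_finite) auto
  with rep_ultra_class(2)[of ?g, OF g]
  have "eventually (\<lambda>i. eval_tm (M i) (\<lambda>v. rep (e v) i) (map_tm (\<lambda>B. rep B i) (Fn f ts)) = rep (ultra_class ?g) i) D"
  proof eventually_elim
    case (elim i)
    then have args: "map (eval_tm (M i) (\<lambda>v. rep (e v) i)) (map (map_tm (\<lambda>B. rep B i)) ts) = ?args i"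
      by simp
    show ?case by (simp only: tm.map eval_tm.simps args elim(1))
  qed
  then show ?case unfolding val using ultra_class_universe[OF g] by simp
qed auto

text \<open>
  Induction on \<open>\<phi>\<close>. Negation needs that the filter is an ultrafilter; for a quantifier, witnesses
  chosen in almost all factors are assembled into one element of the ultraproduct.
\<close>

theorem Los:
  assumes "wf_fm L \<phi>" "pars_fm \<phi> \<subseteq> universe U" "\<And>v. v \<in> fv_fm \<phi> \<Longrightarrow> e v \<in> universe U"
  shows "satisfies U e \<phi> \<longleftrightarrow> eventually (\<lambda>i. satisfies (M i) (\<lambda>v. rep (e v) i) (localize i \<phi>)) D"
  using assms
proof (induction \<phi> arbitrary: e)
  case Falsum
  then show ?case using D_nontrivial by (simp add: localize_def eventually_False)
next
  case (Equal s t)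
  have s: "eval_tm U e s \<in> universe U" "eventually (\<lambda>i. eval_tm (M i) (\<lambda>v. rep (e v) i) (map_tm (\<lambda>B. rep B i) s) = rep (eval_tm U e s) i) D"
    using eval_tm_ultraproduct[of s e] Equal by auto
  have t: "eval_tm U e t \<in> universe U" "eventually (\<lambda>i. eval_tm (M i) (\<lambda>v. rep (e v) i) (map_tm (\<lambda>B. rep B i) t) = rep (eval_tm U e t) i) D"
    using eval_tm_ultraproduct[of t e] Equal by auto
  have "eventually (\<lambda>i. satisfies (M i) (\<lambda>v. rep (e v) i) (localize i (Equal s t)) \<longleftrightarrow>
      rep (eval_tm U e s) i = rep (eval_tm U e t) i) D"
    using s(2) t(2) by eventually_elim (simp add: localize_def)
  then show ?case using universe_ultraproduct_eq_iff[OF s(1) t(1)] by (simp add: eventually_subst)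
next
  case (Rel R ts)
  have IH: "eventually (\<lambda>i. eval_tm (M i) (\<lambda>v. rep (e v) i) (map_tm (\<lambda>B. rep B i) t) = rep (eval_tm U e t) i) D"
    if "t \<in> set ts" for t
    using eval_tm_ultraproduct[of t e] Rel.prems that by (auto simp: list_all_iff)
  let ?args = "\<lambda>i. map (\<lambda>B. rep B i) (map (eval_tm U e) ts)"
  have "eventually (\<lambda>i. \<forall>t\<in>set ts. eval_tm (M i) (\<lambda>v. rep (e v) i) (map_tm (\<lambda>B. rep B i) t)
      = rep (eval_tm U e t) i) D"
    using IH by (intro eventually_ball_finite) auto
  then have "eventually (\<lambda>i. satisfies (M i) (\<lambda>v. rep (e v) i) (localize i (Rel R ts)) \<longleftrightarrow>
      rel_interp (M i) R (?args i)) D"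
  proof eventually_elim
    case (elim i)
    then have args: "map (eval_tm (M i) (\<lambda>v. rep (e v) i)) (map (map_tm (\<lambda>B. rep B i)) ts) = ?args i"
      by simp
    show ?case by (simp only: localize_def fm.map satisfies.simps args)
  qed
  moreover have "satisfies U e (Rel R ts) \<longleftrightarrow> eventually (\<lambda>i. rel_interp (M i) R (?args i)) D"
    by (simp add: ultraproduct_def)
  ultimately show ?case by (simp add: eventually_subst)
next
  case (Neg \<phi>)
  have "satisfies U e \<phi> \<longleftrightarrow> eventually (\<lambda>i. satisfies (M i) (\<lambda>v. rep (e v) i) (localize i \<phi>)) D"
    using Neg.prems by (intro Neg.IH) auto
  then show ?case by (simp add: localize_def eventually_not)
next
  case (Conj \<phi> \<psi>)
  have "satisfies U e \<phi> \<longleftrightarrow> eventually (\<lambda>i. satisfies (M i) (\<lambda>v. rep (e v) i) (localize i \<phi>)) D"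
    "satisfies U e \<psi> \<longleftrightarrow> eventually (\<lambda>i. satisfies (M i) (\<lambda>v. rep (e v) i) (localize i \<psi>)) D"
    using Conj.prems by (intro Conj.IH; auto)+
  then show ?case by (simp add: localize_def eventually_conj_iff)
next
  case (Exists v \<phi>)
  have IH: "satisfies U (e(v := B)) \<phi> \<longleftrightarrow>
      eventually (\<lambda>i. satisfies (M i) ((\<lambda>u. rep (e u) i)(v := rep B i)) (localize i \<phi>)) D"
    if B: "B \<in> universe U" for B
  proof -
    have "satisfies U (e(v := B)) \<phi> \<longleftrightarrow>
      eventually (\<lambda>i. satisfies (M i) (\<lambda>u. rep ((e(v := B)) u) i) (localize i \<phi>)) D"
      using Exists.prems B by (intro Exists.IH) auto
    moreover have "(\<lambda>u. rep ((e(v := B)) u) i) = (\<lambda>u. rep (e u) i)(v := rep B i)" for i by auto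
    ultimately show ?thesis by simp
  qed
  show ?case
  proof
    assume "satisfies U e (Exists v \<phi>)"
    then obtain B where B: "B \<in> universe U" "satisfies U (e(v := B)) \<phi>" by auto
    from B(2)[unfolded IH[OF B(1)]]
    show "eventually (\<lambda>i. satisfies (M i) (\<lambda>v. rep (e v) i) (localize i (Exists v \<phi>))) D"
      by eventually_elim (use rep_universe[OF B(1)] in \<open>auto simp: localize_def\<close>)
  next
    assume ev: "eventually (\<lambda>i. satisfies (M i) (\<lambda>v. rep (e v) i) (localize i (Exists v \<phi>))) D"
    \<comment> \<open>Where no witness exists, an arbitrary element keeps \<open>g\<close> inside the product.\<close>
    have "\<forall>i. \<exists>a. a \<in> universe (M i) \<and> (satisfies (M i) (\<lambda>v. rep (e v) i) (localize i (Exists v \<phi>)) \<longrightarrow>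
        satisfies (M i) ((\<lambda>u. rep (e u) i)(v := a)) (localize i \<phi>))"
    proof
      fix i show "\<exists>a. a \<in> universe (M i) \<and> (satisfies (M i) (\<lambda>v. rep (e v) i) (localize i (Exists v \<phi>)) \<longrightarrow>
          satisfies (M i) ((\<lambda>u. rep (e u) i)(v := a)) (localize i \<phi>))"
        using universe_nonempty[of i] by (auto simp: localize_def)
    qed
    from choice[OF this] obtain g where g: "\<And>i. g i \<in> universe (M i)"
      "\<And>i. satisfies (M i) (\<lambda>v. rep (e v) i) (localize i (Exists v \<phi>)) \<Longrightarrow>
        satisfies (M i) ((\<lambda>u. rep (e u) i)(v := g i)) (localize i \<phi>)" by blast
    have "eventually (\<lambda>i. satisfies (M i) ((\<lambda>u. rep (e u) i)(v := rep (ultra_class g) i)) (localize i \<phi>)) D"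
      using ev rep_ultra_class(2)[of g, OF g(1)] by eventually_elim (simp add: g(2))
    then show "satisfies U e (Exists v \<phi>)"
      using IH[OF ultra_class_universe[OF g(1)]] ultra_class_universe[OF g(1)] by auto
  qed
qed

section \<open>Limits along the ultrafilter\<close>

text \<open>
  Compactness of the unit interval gives a cluster point, and a cluster point of an ultrafilter is
  a limit.
\<close>

lemma ultrafilter_convergence:
  fixes f :: "'i \<Rightarrow> real"
  assumes "\<And>i. 0 \<le> f i \<and> f i \<le> 1"
  shows "(f \<longlongrightarrow> Lim D f) D"
proof -
  have "\<exists>l\<in>{0..1}. inf (nhds l) (filtermap f D) \<noteq> bot"
    using compact_Icc[of "0::real" 1] assms D_nontrivial unfolding compact_filter
    by (auto simp: filtermap_bot_iff eventually_filtermap)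
  then obtain l where l: "inf (nhds l) (filtermap f D) \<noteq> bot" by blast
  have "(f \<longlongrightarrow> l) D"
  proof (rule topological_tendstoI, rule ccontr)
    fix S assume S: "open S" "l \<in> S" "\<not> eventually (\<lambda>i. f i \<in> S) D"
    then have "eventually (\<lambda>x. x \<notin> S) (filtermap f D)" by (simp add: eventually_filtermap eventually_not)
    moreover have "eventually (\<lambda>x. x \<in> S) (nhds l)" using S by (simp add: eventually_nhds_in_open)
    ultimately have "eventually (\<lambda>x. False) (inf (nhds l) (filtermap f D))"
      unfolding eventually_inf by (intro exI[of _ "\<lambda>x. x \<in> S"] exI[of _ "\<lambda>x. x \<notin> S"]) auto
    then show False using l by (simp add: eventually_False)
  qed
  then show ?thesis using tendsto_Lim[OF D_nontrivial] by metis
qed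

lemma localize_formulas: "\<phi> \<in> formulas_over L U X \<Longrightarrow> localize i \<phi> \<in> formulas_over L (M i) X"
  unfolding localize_def by (rule map_fm_formulas) (auto simp: rep_universe)

lemma tendsto_ultralimit:
  assumes "\<And>i. \<mu>s i \<in> keisler_measures L (M i) X" "\<phi> \<in> formulas_over L U X"
  shows "((\<lambda>i. \<mu>s i (localize i \<phi>)) \<longlongrightarrow> ultralimit L D M X \<mu>s \<phi>) D"
proof -
  have "0 \<le> \<mu>s i (localize i \<phi>) \<and> \<mu>s i (localize i \<phi>) \<le> 1" for i
    using assms(1)[of i] localize_formulas[OF assms(2), of i] keisler_nonneg keisler_le_1 by blast
  from ultrafilter_convergence[OF this] show ?thesis
    using assms(2) by (simp add: ultralimit_def localize_def)
qed

definition class_tuple :: "nat set \<Rightarrow> ('i \<Rightarrow> nat \<Rightarrow> 'a) \<Rightarrow> nat \<Rightarrow> ('i \<Rightarrow> 'a) set" where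
  "class_tuple Y b = (\<lambda>v\<in>Y. ultra_class (\<lambda>i. b i v))"

lemma class_tuple:
  assumes b: "\<And>i. b i \<in> tuples (M i) Y" and Y: "finite Y"
  shows "class_tuple Y b \<in> tuples U Y" "eventually (\<lambda>i. \<forall>v\<in>Y. rep (class_tuple Y b v) i = b i v) D"
proof -
  have g: "b i v \<in> universe (M i)" if "v \<in> Y" for i v
    using b[of i] that by (auto simp: tuples_def)
  show "class_tuple Y b \<in> tuples U Y"
    using ultra_class_universe g by (auto simp: tuples_def class_tuple_def)
  show "eventually (\<lambda>i. \<forall>v\<in>Y. rep (class_tuple Y b v) i = b i v) D"
    using rep_ultra_class(2)[OF g] by (intro eventually_ball_finite Y) (simp add: class_tuple_def)
qed

lemma Los_class_tuple:
  assumes b: "\<And>i. b i \<in> tuples (M i) Y" and Y: "finite Y" and \<theta>: "\<theta> \<in> formulas_over L U Y"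
  shows "eventually (\<lambda>i. satisfies (M i) (b i) (localize i \<theta>) \<longleftrightarrow> satisfies U (class_tuple Y b) \<theta>) D"
proof -
  let ?P = "\<lambda>i. satisfies (M i) (\<lambda>v. rep (class_tuple Y b v) i) (localize i \<theta>)"
  have "satisfies U (class_tuple Y b) \<theta> \<longleftrightarrow> eventually ?P D"
    using \<theta> class_tuple(1)[of b Y, OF b Y] by (intro Los) (auto simp: formulas_def tuples_def)
  then have "eventually (\<lambda>i. ?P i \<longleftrightarrow> satisfies U (class_tuple Y b) \<theta>) D"
    using eventually_not[of ?P] by (cases "satisfies U (class_tuple Y b) \<theta>") auto
  with class_tuple(2)[of b Y, OF b Y] show ?thesis
  proof eventually_elim
    case (elim i)
    have "satisfies (M i) (b i) (localize i \<theta>) \<longleftrightarrow> ?P i"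
      using localize_formulas[OF \<theta>, of i] elim(1) by (intro satisfies_cong) (auto simp: formulas_def)
    then show ?case using elim(2) by simp
  qed
qed

lemma tendsto_class_tuple:
  assumes \<mu>s: "\<And>i. \<mu>s i \<in> keisler_measures L (M i) X"
    and b: "\<And>i. b i \<in> tuples (M i) Y" and Y: "finite Y" and \<phi>: "\<phi> \<in> formulas_over L U (X \<union> Y)"
  shows "((\<lambda>i. \<mu>s i (inst_fm Y (b i) (localize i \<phi>))) \<longlongrightarrow>
    ultralimit L D M X \<mu>s (inst_fm Y (class_tuple Y b) \<phi>)) D"
proof (rule Lim_transform_eventually)
  show "((\<lambda>i. \<mu>s i (localize i (inst_fm Y (class_tuple Y b) \<phi>))) \<longlongrightarrow>
    ultralimit L D M X \<mu>s (inst_fm Y (class_tuple Y b) \<phi>)) D"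
    by (rule tendsto_ultralimit[OF \<mu>s inst_fm_formulas_over[OF \<phi> class_tuple(1)[of b Y, OF b Y]]])
  show "eventually (\<lambda>i. \<mu>s i (localize i (inst_fm Y (class_tuple Y b) \<phi>)) = \<mu>s i (inst_fm Y (b i) (localize i \<phi>))) D"
    using class_tuple(2)[of b Y, OF b Y]
  proof eventually_elim
    case (elim i)
    have "localize i (inst_fm Y (class_tuple Y b) \<phi>) = inst_fm Y (b i) (localize i \<phi>)"
      unfolding localize_def map_inst_fm using elim by (intro inst_fm_cong) simp
    then show ?case by simp
  qed
qed

text \<open>
  A uniform estimate over the ultraproduct holds, with any larger error, uniformly over almost all
  factors. Otherwise counterexamples \<open>b i\<close> chosen in almost all factors would form a tuple of the
  ultraproduct; by the theorem of Los each \<open>\<theta> j\<close> holds at almost all \<open>b i\<close> if and only if it holds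
  at this tuple, and the value at the tuple is the limit of the values at the \<open>b i\<close>. This
  contradicts the estimate.
\<close>

lemma step_approx_transfer:
  fixes w :: "'j \<Rightarrow> real"
  assumes \<mu>s: "\<And>i. \<mu>s i \<in> keisler_measures L (M i) X" and Y: "finite Y"
    and \<phi>: "\<phi> \<in> formulas_over L U (X \<union> Y)"
    and J: "finite J" and \<theta>: "\<And>j. j \<in> J \<Longrightarrow> \<theta> j \<in> formulas_over L U Y" and e: "e < e'"
    and approx: "\<And>b. b \<in> tuples U Y \<Longrightarrow>
      \<bar>ultralimit L D M X \<mu>s (inst_fm Y b \<phi>) - (\<Sum>j\<in>J. w j * of_bool (satisfies U b (\<theta> j)))\<bar> \<le> e"
  shows "eventually (\<lambda>i. \<forall>b\<in>tuples (M i) Y. \<bar>\<mu>s i (inst_fm Y b (localize i \<phi>)) -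
      (\<Sum>j\<in>J. w j * of_bool (satisfies (M i) b (localize i (\<theta> j))))\<bar> \<le> e') D"
proof (rule ccontr)
  let ?err = "\<lambda>i b. \<bar>\<mu>s i (inst_fm Y b (localize i \<phi>)) -
      (\<Sum>j\<in>J. w j * of_bool (satisfies (M i) b (localize i (\<theta> j))))\<bar>"
  assume "\<not> eventually (\<lambda>i. \<forall>b\<in>tuples (M i) Y. ?err i b \<le> e') D"
  then have bad: "eventually (\<lambda>i. \<not> (\<forall>b\<in>tuples (M i) Y. ?err i b \<le> e')) D"
    by (simp only: eventually_not not_False_eq_True)
  \<comment> \<open>In the remaining factors any tuple will do; a total choice function is needed.\<close>
  have "\<forall>i. \<exists>b. b \<in> tuples (M i) Y \<and> (\<not> (\<forall>b\<in>tuples (M i) Y. ?err i b \<le> e') \<longrightarrow> \<not> ?err i b \<le> e')"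
    using tuples_nonempty[OF universe_nonempty, of _ Y] by blast
  from choice[OF this] obtain b where b: "\<And>i. b i \<in> tuples (M i) Y"
    and berr: "\<And>i. \<not> (\<forall>b\<in>tuples (M i) Y. ?err i b \<le> e') \<Longrightarrow> \<not> ?err i (b i) \<le> e'" by blast
  let ?b = "class_tuple Y b"
  let ?l = "ultralimit L D M X \<mu>s (inst_fm Y ?b \<phi>)" and ?s = "\<Sum>j\<in>J. w j * of_bool (satisfies U ?b (\<theta> j))"
  have bU: "?b \<in> tuples U Y" by (rule class_tuple(1)[of b Y, OF b Y])
  have "((\<lambda>i. \<mu>s i (inst_fm Y (b i) (localize i \<phi>))) \<longlongrightarrow> ?l) D"
    by (rule tendsto_class_tuple[of \<mu>s X b Y, OF \<mu>s b Y \<phi>])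
  then have "eventually (\<lambda>i. dist (\<mu>s i (inst_fm Y (b i) (localize i \<phi>))) ?l < e' - e) D"
    using e by (intro tendstoD) auto
  moreover have "eventually (\<lambda>i. \<forall>j\<in>J. satisfies (M i) (b i) (localize i (\<theta> j)) \<longleftrightarrow> satisfies U ?b (\<theta> j)) D"
    using J Los_class_tuple[of b Y, OF b Y \<theta>] by (intro eventually_ball_finite) auto
  ultimately have "eventually (\<lambda>i. False) D" using bad
  proof eventually_elim
    case (elim i)
    have "(\<Sum>j\<in>J. w j * of_bool (satisfies (M i) (b i) (localize i (\<theta> j)))) = ?s"
      using elim(2) by (intro sum.cong) auto
    then have "?err i (b i) \<le> e'" using elim(1) approx[OF bU] by (simp add: dist_real_def)
    then show False using berr[OF elim(3)] by simp
  qed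
  then show False using D_nontrivial by (simp add: eventually_False)
qed

section \<open>Comparison of the two products\<close>

text \<open>
  With \<open>e = 1/n\<close> and a step function \<open>s\<close> within \<open>e\<close> of the fiber map, the Morley product over the
  ultraproduct is within \<open>e\<close> of \<open>\<integral> s d\<nu>\<close>, the products in almost all factors are within \<open>2e\<close> of the
  corresponding integrals, and these are almost everywhere within \<open>e\<close> of \<open>\<integral> s d\<nu>\<close>. So four times
  \<open>e\<close> has to be below \<open>\<epsilon>\<close>.
\<close>

lemma tendsto_morley_product:
  assumes fin: "finite X" "finite Y" and XY: "X \<inter> Y = {}"
    and \<mu>s: "pf_witness L D M X \<mu> \<mu>s" and \<nu>s: "pf_witness L D M Y \<nu> \<nu>s"
    and \<nu>: "\<nu> \<in> keisler_measures L U Y" and def: "definable L U X \<mu>"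
    and \<phi>: "\<phi> \<in> formulas_over L U (X \<union> Y)"
  shows "((\<lambda>i. morley_product L (M i) X Y (\<mu>s i) (\<nu>s i) (localize i \<phi>)) \<longlongrightarrow> morley_product L U X Y \<mu> \<nu> \<phi>) D"
proof (rule tendstoI)
  fix \<epsilon> :: real assume \<epsilon>: "0 < \<epsilon>"
  obtain F where F: "is_fiber_map L U Y \<mu> \<phi> F"
    using definable_fiber_map[OF def fin XY \<phi>] by blast
  obtain m where m: "1 / real (Suc m) < \<epsilon> / 4" using \<epsilon> nat_approx_posE[of "\<epsilon> / 4"] by auto
  define n where "n = Suc m"
  have n: "0 < n" "1 / real n < \<epsilon> / 4" using m by (auto simp: n_def)
  obtain \<theta> where \<theta>: "\<And>j. j < n \<Longrightarrow> \<theta> j \<in> formulas_over L U Y"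
    and approx: "\<And>p. p \<in> types L U Y \<Longrightarrow> \<bar>F p - (\<Sum>j<n. 1 / n * indicator (type_cyl L U Y (\<theta> j)) p)\<bar> \<le> 1 / n"
    using step_approx[OF is_fiber_map_continuous[OF F] n(1)] by blast
  have approxU: "\<bar>\<mu> (inst_fm Y b \<phi>) - (\<Sum>j<n. 1 / n * of_bool (satisfies U b (\<theta> j)))\<bar> \<le> 1 / n"
    if b: "b \<in> tuples U Y" for b
  proof -
    have "(\<Sum>j<n. 1 / n * indicator (type_cyl L U Y (\<theta> j)) (tp L U Y b)) = (\<Sum>j<n. 1 / n * of_bool (satisfies U b (\<theta> j)))"
      using \<theta> by (intro sum.cong) (auto simp: indicator_def tp_type_cyl[OF b])
    then show ?thesis using approx[OF tp_types[OF b]] F b by (simp add: is_fiber_map_def)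
  qed
  have K\<mu>: "\<mu>s i \<in> keisler_measures L (M i) X" and C\<mu>: "\<mu>s i \<in> conv_measures L (M i) X"
    and K\<nu>: "\<nu>s i \<in> keisler_measures L (M i) Y" for i
    using \<mu>s \<nu>s by (auto simp: pf_witness_def intro: conv_measures_keisler)
  have \<mu>_eq: "\<mu> = ultralimit L D M X \<mu>s" and \<nu>_eq: "\<nu> = ultralimit L D M Y \<nu>s"
    using \<mu>s \<nu>s by (auto simp: pf_witness_def)
  have U_est: "\<bar>morley_product L U X Y \<mu> \<nu> \<phi> - (\<Sum>j<n. 1 / n * \<nu> (\<theta> j))\<bar> \<le> 1 / n"
    using \<theta> approxU by (intro morley_product_approx[OF \<nu> F \<phi>]) auto
  have "eventually (\<lambda>i. \<forall>b\<in>tuples (M i) Y. \<bar>\<mu>s i (inst_fm Y b (localize i \<phi>)) -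
      (\<Sum>j<n. 1 / n * of_bool (satisfies (M i) b (localize i (\<theta> j))))\<bar> \<le> 2 / n) D"
    using \<theta> approxU n(1) unfolding \<mu>_eq
    by (intro step_approx_transfer[OF K\<mu> fin(2) \<phi>, where e = "1 / n"]) (auto simp: divide_strict_right_mono)
  moreover have "((\<lambda>i. \<Sum>j<n. 1 / n * \<nu>s i (localize i (\<theta> j))) \<longlongrightarrow> (\<Sum>j<n. 1 / n * \<nu> (\<theta> j))) D"
    unfolding \<nu>_eq using \<theta> by (intro tendsto_sum tendsto_mult tendsto_const tendsto_ultralimit K\<nu>) auto
  then have "eventually (\<lambda>i. dist (\<Sum>j<n. 1 / n * \<nu>s i (localize i (\<theta> j))) (\<Sum>j<n. 1 / n * \<nu> (\<theta> j)) < 1 / n) D"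
    using n(1) by (intro tendstoD) auto
  ultimately show "eventually (\<lambda>i. dist (morley_product L (M i) X Y (\<mu>s i) (\<nu>s i) (localize i \<phi>))
      (morley_product L U X Y \<mu> \<nu> \<phi>) < \<epsilon>) D"
  proof eventually_elim
    case (elim i)
    obtain G where G: "is_fiber_map L (M i) Y (\<mu>s i) (localize i \<phi>) G"
      using conv_measures_fiber_map[OF C\<mu> XY localize_formulas[OF \<phi>]] by blast
    have "\<bar>morley_product L (M i) X Y (\<mu>s i) (\<nu>s i) (localize i \<phi>) - (\<Sum>j<n. 1 / n * \<nu>s i (localize i (\<theta> j)))\<bar> \<le> 2 / n"
      using elim(1) \<theta> by (intro morley_product_approx[OF K\<nu> G localize_formulas[OF \<phi>]]) (auto intro: localize_formulas)
    moreover have "2 / real n = 2 * (1 / n)" by simp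
    ultimately show ?case
      using elim(2) U_est n(2) unfolding dist_real_def by linarith
  qed
qed

lemma ultralimit_morley_product:
  assumes "finite X" "finite Y" "X \<inter> Y = {}"
    "pf_witness L D M X \<mu> \<mu>s" "pf_witness L D M Y \<nu> \<nu>s"
    "\<nu> \<in> keisler_measures L U Y" "definable L U X \<mu>"
  shows "ultralimit L D M (X \<union> Y) (\<lambda>i. morley_product L (M i) X Y (\<mu>s i) (\<nu>s i)) = morley_product L U X Y \<mu> \<nu>"
  using tendsto_Lim[OF D_nontrivial tendsto_morley_product[OF assms]]
  unfolding ultralimit_def localize_def[symmetric] morley_product_def[of L U]
  by (intro restrict_ext) (auto simp: morley_product_def)

end

text \<open>
  The limit has been computed for arbitrary witnesses of pseudo-finiteness and is the Morley product
  for all of them, which is also what makes the definite description of the pseudo-finite product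
  denote.
\<close>

theorem theorem4p8:
  fixes L :: "('f, 'r) language"
    and M :: "'i \<Rightarrow> ('f, 'r, 'a) fo_struct"
    and D :: "'i filter"
    and X Y :: "nat set"
    and \<mu> \<nu> :: "('f, 'r, ('i \<Rightarrow> 'a) set) fm \<Rightarrow> real"
  assumes "infinite (UNIV :: 'i set)"
    and "\<And>i. is_struct L (M i)"
    and "nonprincipal_ultrafilter D"
    and "finite X" and "finite Y" and "X \<inter> Y = {}"
    and "\<mu> \<in> keisler_measures L (ultraproduct D M) X"
    and "\<nu> \<in> keisler_measures L (ultraproduct D M) Y"
    and "pseudo_finite L D M X \<mu>"
    and "pseudo_finite L D M Y \<nu>"
    and "definable L (ultraproduct D M) X \<mu>"
  shows "morley_product L (ultraproduct D M) X Y \<mu> \<nu> = pf_product L D M X Y \<mu> \<nu>"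
proof -
  interpret ultraproduct_family L M D by unfold_locales (rule assms)+
  have eq: "ultralimit L D M (X \<union> Y) (\<lambda>i. morley_product L (M i) X Y (\<mu>s i) (\<nu>s i))
      = morley_product L (ultraproduct D M) X Y \<mu> \<nu>"
    if "pf_witness L D M X \<mu> \<mu>s" "pf_witness L D M Y \<nu> \<nu>s" for \<mu>s \<nu>s
    by (rule ultralimit_morley_product) (use assms that in auto)
  obtain \<mu>s \<nu>s where w: "pf_witness L D M X \<mu> \<mu>s" "pf_witness L D M Y \<nu> \<nu>s"
    using assms(9,10) by (auto simp: pseudo_finite_def)
  show ?thesis
    unfolding pf_product_def
  proof (rule the_equality[symmetric])
    show "\<exists>\<mu>s \<nu>s. pf_witness L D M X \<mu> \<mu>s \<and> pf_witness L D M Y \<nu> \<nu>s \<and>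
      morley_product L (ultraproduct D M) X Y \<mu> \<nu> =
        ultralimit L D M (X \<union> Y) (\<lambda>i. morley_product L (M i) X Y (\<mu>s i) (\<nu>s i))"
      using w eq[OF w] by (intro exI[of _ \<mu>s] exI[of _ \<nu>s]) simp
  next
    fix \<rho>
    assume "\<exists>\<mu>s \<nu>s. pf_witness L D M X \<mu> \<mu>s \<and> pf_witness L D M Y \<nu> \<nu>s \<and>
      \<rho> = ultralimit L D M (X \<union> Y) (\<lambda>i. morley_product L (M i) X Y (\<mu>s i) (\<nu>s i))"
    then show "\<rho> = morley_product L (ultraproduct D M) X Y \<mu> \<nu>" using eq by blast
  qed
qed

end
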